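(* Let $(\mathbf{G},\lambda,\mu)$ be a measured groupoid. If there exists an invariant Markov operator $P$ on $(\mathbf{G},\lambda,\mu)$ which is fiberwise Liouville (i.e., $(\mathbf{G},\lambda,\mu)$ is a Liouville measured groupoid), then the measured groupoid $(\mathbf{G},\lambda,\mu)$ is amenable.
   Context: Groupoids. A groupoid $\mathbf{G}$ is a small category in which every morphism is invertible; $\mathbf{G}$ also denotes its set of morphisms, $\mathbf{G}^{(0)}$ its set of objects, identified with a subset of $\mathbf{G}$ via $x\mapsto\boldsymbol{\varepsilon}_x$ (identity morphism at $x$), and $\mathsf{s},\mathsf{t}:\mathbf{G}\to\mathbf{G}^{(0)}$ the source and target maps. $\mathbf{G}^{(2)}=\{(g_1,g_2):\mathsf{s}(g_1)=\mathsf{t}(g_2)\}$ is the set of composable pairs, with $\mathsf{s}(g_1g_2)=\mathsf{s}(g_2)$, $\mathsf{t}(g_1g_2)=\mathsf{t}(g_1)$. Put $\mathbf{G}^x=\mathsf{t}^{-1}(x)$. Each $g\in\mathbf{G}$ gives a bijection $\mathbf{G}^{\mathsf{s}(g)}\to\mathbf{G}^{\mathsf{t}(g)}$, $h\mapsto gh$, and $g\theta$ denotes the image of a measure $\theta$ on $\mathbf{G}^{\mathsf{s}(g)}$ under it. $\mathbf{G}$ is Borel if it carries a Borel structure for which all structure maps are Borel. Measured groupoids. A Borel Haar system on a Borel groupoid is a family $\lambda=\{\lambda^x\}_{x\in\mathbf{G}^{(0)}}$ of measures, $\lambda^x$ concentrated on $\mathbf{G}^x$, which is Borel (for every non-negative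 Borel $f$ on $\mathbf{G}$ the function $x\mapsto\langle\lambda^x,f\rangle$ is Borel), proper (there is a non-negative Borel $f$ with $\langle\lambda^x,f\rangle=1$ for all $x$) and invariant: $g\lambda^{\mathsf{s}(g)}=\lambda^{\mathsf{t}(g)}$ for all $g\in\mathbf{G}$. For a Borel measure $\mu$ on $\mathbf{G}^{(0)}$, $\lambda\star\mu=\int\lambda^x\,d\mu(x)$ is a measure on $\mathbf{G}$; $\mu$ is quasi-invariant if $\lambda\star\mu$ is equivalent to its image under $g\mapsto g^{-1}$. A measured groupoid is a triple $(\mathbf{G},\lambda,\mu)$ with $\mathbf{G}$ a Borel groupoid, $\lambda$ a Borel Haar system, and $\mu$ quasi-invariant. Amenability. For a system $\theta=\{\theta^x\}$ of finite measures on the fibers $\mathbf{G}^x$, absolutely continuous with respect to $\lambda$, put $(\theta*f)(g)=\int f(h^{-1}g)\,d\theta^{\mathsf{t}(g)}(h)$ for functions $f$ on $\mathbf{G}$ and $(\theta*\varphi)(x)=\int\varphi(\mathsf{s}(h))\,d\theta^x(h)$ for functions $\varphi$ on $\mathbf{G}^{(0)}$. $(\mathbf{G},\lambda,\mu)$ is amenable if there is a positive normalized linear map (mean) $\boldsymbol\Pi:L^\infty(\mathbf{G},\lambda\star\mu)\to L^\infty(\mathbf{G}^{(0)},\mu)$ (where $\mathbf{G}^{(0)}$ is regarded as the quotient of $\mathbf{G}$ under $\mathsf{t}$) with $\boldsymbol\Pi(\theta*f)=\theta*\boldsymbol\Pi(f)$ for all such $\theta$ and $f$. Equivalently: there is a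 sequence $\theta_n=\{\theta_n^x\}$ of systems of probability measures on the fibers $\mathbf{G}^x$, absolutely continuous with respect to $\lambda^x$ with density $d\theta_n^{\mathsf{t}(g)}/d\lambda^{\mathsf{t}(g)}(g)$ measurable on $\mathbf{G}$, such that $\int\|g\theta_n^{\mathsf{s}(g)}-\theta_n^{\mathsf{t}(g)}\|\,f(g)\,d(\lambda\star\mu)(g)\to0$ for every $f\in L^1(\mathbf{G},\lambda\star\mu)$ (total variation norm). Markov operators. A Markov operator $P$ on a Borel space $X$ is given by a Borel family $\pi=\{\pi_x\}_{x\in X}$ of Borel probability measures on $X$ (transition probabilities) via $Pf(x)=\langle\pi_x,f\rangle$; it acts on measures by $\theta P=\int\pi_x\,d\theta(x)$. A $\sigma$-finite measure $m$ is $P$-adapted if $mP$ is absolutely continuous with respect to $m$; then $P$ acts on $L^\infty(X,m)$. $P:L^\infty(X,m)\to L^\infty(X,m)$ is Liouville if every $f\in L^\infty(X,m)$ with $Pf=f$ is constant (a.e.). Invariant operators. A Markov operator on a Borel groupoid $\mathbf{G}$ is invariant if its transition probabilities satisfy $\pi_{g'g}=g'\pi_g$ for all $(g',g)\in\mathbf{G}^{(2)}$; in particular $\pi_g$ is concentrated on $\mathbf{G}^{\mathsf{t}(g)}$, so $P$ restricts to Markov operators $P_x$ on the fibers $\mathbf{G}^x$. By an invariant Markov operator on a measured groupoid $(\mathbf{G},\lambda,\mu)$ one means one for which $\lambda\star\mu$ is $P$-adapted (equivalently, $\lambda^x$ is $P_x$-adapted for $\mu$-a.e. $x$). It is fiberwise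 Liouville if $P_x:L^\infty(\mathbf{G}^x,\lambda^x)\to L^\infty(\mathbf{G}^x,\lambda^x)$ is Liouville for $\mu$-a.e. $x\in\mathbf{G}^{(0)}$. *)

theory Defs
  imports "HOL-Probability.Probability"
begin

section \<open>Systems of measures\<close>

text \<open>
  Borel spaces are represented by values of type \<^typ>\<open>'a measure\<close>, of which only the carrier and the
  sigma-algebra are used; no separation or standardness is assumed. Since a subset \<open>A\<close> of a Borel
  space \<open>Y\<close> (e.g. a fiber of a groupoid) then need not be Borel, a measure on \<open>Y\<close> concentrated on
  \<open>A\<close> is encoded as a measure on the trace sigma-algebra of \<open>A\<close>. For Borel \<open>A\<close> this is the same thing.

  A Borel system: \<open>\<kappa> x\<close> is a measure on \<open>Y\<close> concentrated on \<open>F x\<close>, depending on \<open>x\<close> in a Borel way.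
\<close>

definition borel_system ::
  "'x measure \<Rightarrow> 'y measure \<Rightarrow> ('x \<Rightarrow> 'y set) \<Rightarrow> ('x \<Rightarrow> 'y measure) \<Rightarrow> bool" where
  "borel_system X Y F \<kappa> \<longleftrightarrow>
     (\<forall>x\<in>space X. sets (\<kappa> x) = sets (restrict_space Y (F x))) \<and>
     (\<forall>f :: 'y \<Rightarrow> ennreal. f \<in> borel_measurable Y \<longrightarrow>
        (\<lambda>x. \<integral>\<^sup>+ y. f y \<partial>\<kappa> x) \<in> borel_measurable X)"

text \<open>
  The measure \<open>\<integral> \<kappa> x d\<mu>(x)\<close> on \<open>Y\<close>. It gives both \<open>\<lambda> \<star> \<mu>\<close> for a Haar system \<open>\<lambda>\<close> and \<open>\<mu>P\<close> for a
  Markov operator \<open>P\<close>. (The monadic bind only handles subprobability kernels.)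
\<close>

definition integrate_system ::
  "'y measure \<Rightarrow> ('x \<Rightarrow> 'y measure) \<Rightarrow> 'x measure \<Rightarrow> 'y measure" where
  "integrate_system Y \<kappa> \<mu> =
     measure_of (space Y) (sets Y) (\<lambda>A. \<integral>\<^sup>+ x. emeasure (\<kappa> x) (A \<inter> space (\<kappa> x)) \<partial>\<mu>)"

lemma sets_integrate_system [simp]: "sets (integrate_system Y \<kappa> \<mu>) = sets Y"
  and space_integrate_system [simp]: "space (integrate_system Y \<kappa> \<mu>) = space Y"
  by (simp_all add: integrate_system_def)

lemma borel_system_emeasure:
  assumes \<kappa>: "borel_system X Y F \<kappa>" and x: "x \<in> space X" and A: "A \<in> sets Y"
  shows "A \<inter> space (\<kappa> x) \<in> sets (\<kappa> x)"
    and "emeasure (\<kappa> x) (A \<inter> space (\<kappa> x)) = (\<integral>\<^sup>+ y. indicator A y \<partial>\<kappa> x)"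
proof -
  have s: "sets (\<kappa> x) = sets (restrict_space Y (F x))"
    using \<kappa> x by (auto simp: borel_system_def)
  then have sp: "space (\<kappa> x) = F x \<inter> space Y"
    using sets_eq_imp_space_eq[OF s] by (auto simp: space_restrict_space)
  have "A \<inter> space (\<kappa> x) = F x \<inter> A"
    using sets.sets_into_space[OF A] sp by auto
  then show 1: "A \<inter> space (\<kappa> x) \<in> sets (\<kappa> x)"
    using A by (auto simp: s sets_restrict_space)
  have "(\<integral>\<^sup>+ y. indicator A y \<partial>\<kappa> x) = (\<integral>\<^sup>+ y. indicator (A \<inter> space (\<kappa> x)) y \<partial>\<kappa> x)"
    by (intro nn_integral_cong) (auto simp: indicator_def)
  then show "emeasure (\<kappa> x) (A \<inter> space (\<kappa> x)) = (\<integral>\<^sup>+ y. indicator A y \<partial>\<kappa> x)"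
    using 1 by simp
qed

lemma emeasure_integrate_system:
  assumes \<kappa>: "borel_system X Y F \<kappa>" and \<mu>: "sets \<mu> = sets X" and A: "A \<in> sets Y"
  shows "emeasure (integrate_system Y \<kappa> \<mu>) A =
         (\<integral>\<^sup>+ x. emeasure (\<kappa> x) (A \<inter> space (\<kappa> x)) \<partial>\<mu>)"
proof (rule emeasure_measure_of[OF integrate_system_def])
  let ?m = "\<lambda>A. \<integral>\<^sup>+ x. emeasure (\<kappa> x) (A \<inter> space (\<kappa> x)) \<partial>\<mu>"
  note sp = sets_eq_imp_space_eq[OF \<mu>]
  show "sets Y \<subseteq> Pow (space Y)" by (rule sets.space_closed)
  show "A \<in> sets (integrate_system Y \<kappa> \<mu>)" using A by simp
  show "positive (sets (integrate_system Y \<kappa> \<mu>)) ?m" by (simp add: positive_def)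
  show "countably_additive (sets (integrate_system Y \<kappa> \<mu>)) ?m"
  proof (rule countably_additiveI)
    fix B :: "nat \<Rightarrow> _"
    assume "range B \<subseteq> sets (integrate_system Y \<kappa> \<mu>)" and d: "disjoint_family B"
    then have B: "B n \<in> sets Y" for n by auto
    have m: "(\<lambda>x. emeasure (\<kappa> x) (B n \<inter> space (\<kappa> x))) \<in> borel_measurable \<mu>" for n
    proof -
      have "(\<lambda>x. \<integral>\<^sup>+ y. indicator (B n) y \<partial>\<kappa> x) \<in> borel_measurable X"
        using \<kappa> B[of n] by (auto simp: borel_system_def)
      then have "(\<lambda>x. \<integral>\<^sup>+ y. indicator (B n) y \<partial>\<kappa> x) \<in> borel_measurable \<mu>"
        using \<mu> by (simp cong: measurable_cong_sets)
      moreover have "emeasure (\<kappa> x) (B n \<inter> space (\<kappa> x)) = (\<integral>\<^sup>+ y. indicator (B n) y \<partial>\<kappa> x)"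
        if "x \<in> space \<mu>" for x
        using borel_system_emeasure(2)[OF \<kappa> _ B] that sp by auto
      ultimately show ?thesis by (subst measurable_cong) auto
    qed
    have "(\<Sum>n. ?m (B n)) = (\<integral>\<^sup>+ x. (\<Sum>n. emeasure (\<kappa> x) (B n \<inter> space (\<kappa> x))) \<partial>\<mu>)"
      by (rule nn_integral_suminf[symmetric]) (rule m)
    also have "\<dots> = ?m (\<Union>n. B n)"
    proof (rule nn_integral_cong)
      fix x assume "x \<in> space \<mu>"
      then have "range (\<lambda>n. B n \<inter> space (\<kappa> x)) \<subseteq> sets (\<kappa> x)"
        using borel_system_emeasure(1)[OF \<kappa> _ B] sp by auto
      moreover have "disjoint_family (\<lambda>n. B n \<inter> space (\<kappa> x))"
        using d by (auto simp: disjoint_family_on_def)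
      ultimately show "(\<Sum>n. emeasure (\<kappa> x) (B n \<inter> space (\<kappa> x))) =
          emeasure (\<kappa> x) ((\<Union>n. B n) \<inter> space (\<kappa> x))"
        unfolding UN_simps(4)[symmetric] by (rule suminf_emeasure)
    qed
    finally show "(\<Sum>n. ?m (B n)) = ?m (\<Union>n. B n)" .
  qed
qed

section \<open>Groupoids\<close>

text \<open>
  The set of objects and the set of morphisms are the carriers of the spaces \<open>obj\<close> and \<open>arr\<close>;
  \<open>idt x\<close> is the identity at \<open>x\<close> and \<open>gmul g h\<close> the product \<open>gh\<close>, meaningful if \<open>src g = tgt h\<close>.
\<close>

record ('x, 'g) groupoid_data =
  obj :: "'x measure"
  arr :: "'g measure"
  src :: "'g \<Rightarrow> 'x"
  tgt :: "'g \<Rightarrow> 'x"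
  idt :: "'x \<Rightarrow> 'g"
  ginv :: "'g \<Rightarrow> 'g"
  gmul :: "'g \<Rightarrow> 'g \<Rightarrow> 'g"

definition composable :: "('x, 'g) groupoid_data \<Rightarrow> ('g \<times> 'g) set" where
  "composable G = {(g, h). g \<in> space (arr G) \<and> h \<in> space (arr G) \<and> src G g = tgt G h}"

definition fib :: "('x, 'g) groupoid_data \<Rightarrow> 'x \<Rightarrow> 'g set" where
  "fib G x = {g \<in> space (arr G). tgt G g = x}"

definition groupoid :: "('x, 'g) groupoid_data \<Rightarrow> bool" where
  "groupoid G \<longleftrightarrow>
     (\<forall>x\<in>space (obj G). idt G x \<in> space (arr G) \<and> src G (idt G x) = x \<and> tgt G (idt G x) = x) \<and>
     (\<forall>g\<in>space (arr G).
        src G g \<in> space (obj G) \<and> tgt G g \<in> space (obj G) \<and>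
        gmul G (idt G (tgt G g)) g = g \<and> gmul G g (idt G (src G g)) = g) \<and>
     (\<forall>(g, h)\<in>composable G.
        gmul G g h \<in> space (arr G) \<and>
        src G (gmul G g h) = src G h \<and> tgt G (gmul G g h) = tgt G g) \<and>
     (\<forall>g h k. (g, h) \<in> composable G \<longrightarrow> (h, k) \<in> composable G \<longrightarrow>
        gmul G (gmul G g h) k = gmul G g (gmul G h k)) \<and>
     (\<forall>g\<in>space (arr G).
        ginv G g \<in> space (arr G) \<and> src G (ginv G g) = tgt G g \<and> tgt G (ginv G g) = src G g \<and>
        gmul G g (ginv G g) = idt G (tgt G g) \<and> gmul G (ginv G g) g = idt G (src G g))"

definition borel_groupoid :: "('x, 'g) groupoid_data \<Rightarrow> bool" where
  "borel_groupoid G \<longleftrightarrow>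
     groupoid G \<and>
     src G \<in> measurable (arr G) (obj G) \<and>
     tgt G \<in> measurable (arr G) (obj G) \<and>
     idt G \<in> measurable (obj G) (arr G) \<and>
     ginv G \<in> measurable (arr G) (arr G) \<and>
     (\<lambda>(g, h). gmul G g h) \<in>
       measurable (restrict_space (arr G \<Otimes>\<^sub>M arr G) (composable G)) (arr G)"

text \<open>The image \<open>g\<theta>\<close> of a measure \<open>\<theta>\<close> on the fiber over \<open>src g\<close> under \<open>h \<mapsto> gh\<close>.\<close>

definition translate :: "('x, 'g) groupoid_data \<Rightarrow> 'g \<Rightarrow> 'g measure \<Rightarrow> 'g measure" where
  "translate G g \<theta> = distr \<theta> (restrict_space (arr G) (fib G (tgt G g))) (gmul G g)"

lemma gmul_measurable_fib:
  assumes "borel_groupoid G" and g: "g \<in> space (arr G)"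
  shows "gmul G g \<in> measurable (restrict_space (arr G) (fib G (src G g)))
                              (restrict_space (arr G) (fib G (tgt G g)))"
proof (rule measurable_restrict_space2)
  have gr: "groupoid G"
    and m: "(\<lambda>(g, h). gmul G g h) \<in>
      measurable (restrict_space (arr G \<Otimes>\<^sub>M arr G) (composable G)) (arr G)"
    using assms(1) by (auto simp: borel_groupoid_def)
  show "gmul G g \<in> space (restrict_space (arr G) (fib G (src G g))) \<rightarrow> fib G (tgt G g)"
    using gr g by (fastforce simp: space_restrict_space fib_def groupoid_def composable_def)
  have "(\<lambda>h. (g, h)) \<in> measurable (restrict_space (arr G) (fib G (src G g)))
      (restrict_space (arr G \<Otimes>\<^sub>M arr G) (composable G))"
    using g by (intro measurable_restrict_space2 measurable_restrict_space1)
      (auto simp: space_restrict_space fib_def composable_def)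
  from measurable_comp[OF this m]
  show "gmul G g \<in> measurable (restrict_space (arr G) (fib G (src G g))) (arr G)"
    by (simp add: o_def)
qed

section \<open>Measured groupoids\<close>

definition borel_haar_system ::
  "('x, 'g) groupoid_data \<Rightarrow> ('x \<Rightarrow> 'g measure) \<Rightarrow> bool" where
  "borel_haar_system G lam \<longleftrightarrow>
     borel_system (obj G) (arr G) (fib G) lam \<and>
     (\<exists>f :: 'g \<Rightarrow> ennreal. f \<in> borel_measurable (arr G) \<and>
        (\<forall>x\<in>space (obj G). (\<integral>\<^sup>+ g. f g \<partial>lam x) = 1)) \<and>
     (\<forall>g\<in>space (arr G). translate G g (lam (src G g)) = lam (tgt G g))"

abbreviation haar_measure ::
  "('x, 'g) groupoid_data \<Rightarrow> ('x \<Rightarrow> 'g measure) \<Rightarrow> 'x measure \<Rightarrow> 'g measure" where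
  "haar_measure G lam \<mu> \<equiv> integrate_system (arr G) lam \<mu>"

definition quasi_invariant ::
  "('x, 'g) groupoid_data \<Rightarrow> ('x \<Rightarrow> 'g measure) \<Rightarrow> 'x measure \<Rightarrow> bool" where
  "quasi_invariant G lam \<mu> \<longleftrightarrow>
     (let m = haar_measure G lam \<mu>; m' = distr m (arr G) (ginv G)
      in absolutely_continuous m m' \<and> absolutely_continuous m' m)"

definition measured_groupoid ::
  "('x, 'g) groupoid_data \<Rightarrow> ('x \<Rightarrow> 'g measure) \<Rightarrow> 'x measure \<Rightarrow> bool" where
  "measured_groupoid G lam \<mu> \<longleftrightarrow>
     borel_groupoid G \<and> borel_haar_system G lam \<and>
     sets \<mu> = sets (obj G) \<and> quasi_invariant G lam \<mu>"

section \<open>Amenability\<close>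

text \<open>
  Representatives of the elements of \<open>L\<^sup>\<infinity>(M)\<close>. A map between \<open>L\<^sup>\<infinity>\<close>-spaces is encoded as a map between
  representatives that respects equality almost everywhere.
\<close>

definition Linf :: "'a measure \<Rightarrow> ('a \<Rightarrow> real) set" where
  "Linf M = {f \<in> borel_measurable M. \<exists>C. AE x in M. \<bar>f x\<bar> \<le> C}"

definition linf_mean ::
  "'a measure \<Rightarrow> 'b measure \<Rightarrow> (('a \<Rightarrow> real) \<Rightarrow> ('b \<Rightarrow> real)) \<Rightarrow> bool" where
  "linf_mean M N T \<longleftrightarrow>
     (\<forall>f\<in>Linf M. T f \<in> Linf N) \<and>
     (\<forall>f\<in>Linf M. \<forall>g\<in>Linf M. (AE x in M. f x = g x) \<longrightarrow> (AE y in N. T f y = T g y)) \<and>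
     (\<forall>f\<in>Linf M. \<forall>g\<in>Linf M. AE y in N. T (\<lambda>x. f x + g x) y = T f y + T g y) \<and>
     (\<forall>f\<in>Linf M. \<forall>c. AE y in N. T (\<lambda>x. c * f x) y = c * T f y) \<and>
     (\<forall>f\<in>Linf M. (AE x in M. 0 \<le> f x) \<longrightarrow> (AE y in N. 0 \<le> T f y)) \<and>
     (AE y in N. T (\<lambda>x. 1) y = 1)"

definition finite_ac_system ::
  "('x, 'g) groupoid_data \<Rightarrow> ('x \<Rightarrow> 'g measure) \<Rightarrow> ('x \<Rightarrow> 'g measure) \<Rightarrow> bool" where
  "finite_ac_system G lam \<theta> \<longleftrightarrow>
     borel_system (obj G) (arr G) (fib G) \<theta> \<and>
     (\<forall>x\<in>space (obj G). finite_measure (\<theta> x) \<and> absolutely_continuous (lam x) (\<theta> x))"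

definition conv_arr ::
  "('x, 'g) groupoid_data \<Rightarrow> ('x \<Rightarrow> 'g measure) \<Rightarrow> ('g \<Rightarrow> real) \<Rightarrow> 'g \<Rightarrow> real" where
  "conv_arr G \<theta> f g = (\<integral> h. f (gmul G (ginv G h) g) \<partial>\<theta> (tgt G g))"

definition conv_obj ::
  "('x, 'g) groupoid_data \<Rightarrow> ('x \<Rightarrow> 'g measure) \<Rightarrow> ('x \<Rightarrow> real) \<Rightarrow> 'x \<Rightarrow> real" where
  "conv_obj G \<theta> \<phi> x = (\<integral> h. \<phi> (src G h) \<partial>\<theta> x)"

text \<open>
  The total masses of the \<open>\<theta> x\<close> need not be uniformly bounded, so \<open>\<theta> * f\<close> may fail to be essentially
  bounded; equivariance is required whenever it is, i.e. whenever \<open>T(\<theta> * f)\<close> makes sense. In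
  particular it is required for all \<open>f\<close> if the masses are bounded.
\<close>

definition amenable ::
  "('x, 'g) groupoid_data \<Rightarrow> ('x \<Rightarrow> 'g measure) \<Rightarrow> 'x measure \<Rightarrow> bool" where
  "amenable G lam \<mu> \<longleftrightarrow>
     (\<exists>T. linf_mean (haar_measure G lam \<mu>) \<mu> T \<and>
        (\<forall>\<theta> f. finite_ac_system G lam \<theta> \<longrightarrow>
           f \<in> Linf (haar_measure G lam \<mu>) \<longrightarrow>
           conv_arr G \<theta> f \<in> Linf (haar_measure G lam \<mu>) \<longrightarrow>
           (AE x in \<mu>. T (conv_arr G \<theta> f) x = conv_obj G \<theta> (T f) x)))"

section \<open>Markov operators\<close>

text \<open>
  Transition probabilities on \<open>X\<close>, with \<open>\<pi> x\<close> concentrated on \<open>F x\<close>; the case \<open>F x = space X\<close> is that of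
  a general Markov operator on \<open>X\<close>.
\<close>

definition transition_probabilities ::
  "'a measure \<Rightarrow> ('a \<Rightarrow> 'a set) \<Rightarrow> ('a \<Rightarrow> 'a measure) \<Rightarrow> bool" where
  "transition_probabilities X F \<pi> \<longleftrightarrow>
     borel_system X X F \<pi> \<and> (\<forall>x\<in>space X. prob_space (\<pi> x))"

definition markov_op :: "('a \<Rightarrow> 'a measure) \<Rightarrow> ('a \<Rightarrow> real) \<Rightarrow> 'a \<Rightarrow> real" where
  "markov_op \<pi> f x = (\<integral> y. f y \<partial>\<pi> x)"

definition adapted :: "('a \<Rightarrow> 'a measure) \<Rightarrow> 'a measure \<Rightarrow> bool" where
  "adapted \<pi> m \<longleftrightarrow>
     sigma_finite_measure m \<and> absolutely_continuous m (integrate_system m \<pi> m)"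

definition liouville :: "('a \<Rightarrow> 'a measure) \<Rightarrow> 'a measure \<Rightarrow> bool" where
  "liouville \<pi> m \<longleftrightarrow>
     (\<forall>f\<in>Linf m. (AE x in m. markov_op \<pi> f x = f x) \<longrightarrow> (\<exists>c. AE x in m. f x = c))"

definition invariant_markov ::
  "('x, 'g) groupoid_data \<Rightarrow> ('g \<Rightarrow> 'g measure) \<Rightarrow> bool" where
  "invariant_markov G \<pi> \<longleftrightarrow>
     transition_probabilities (arr G) (\<lambda>g. fib G (tgt G g)) \<pi> \<and>
     (\<forall>(g', g)\<in>composable G. \<pi> (gmul G g' g) = translate G g' (\<pi> g))"

definition invariant_markov_on_measured ::
  "('x, 'g) groupoid_data \<Rightarrow> ('x \<Rightarrow> 'g measure) \<Rightarrow> 'x measure \<Rightarrow> ('g \<Rightarrow> 'g measure) \<Rightarrow> bool" where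
  "invariant_markov_on_measured G lam \<mu> \<pi> \<longleftrightarrow>
     invariant_markov G \<pi> \<and> adapted \<pi> (haar_measure G lam \<mu>)"

text \<open>
  For \<open>g\<close> in the fiber over \<open>x\<close> the measure \<open>\<pi> g\<close> lives on that fiber, so the transition probabilities of
  \<open>P\<^sub>x\<close> are simply those of \<open>P\<close>.
\<close>

definition fiberwise_liouville ::
  "('x \<Rightarrow> 'g measure) \<Rightarrow> 'x measure \<Rightarrow> ('g \<Rightarrow> 'g measure) \<Rightarrow> bool" where
  "fiberwise_liouville lam \<mu> \<pi> \<longleftrightarrow> (AE x in \<mu>. liouville \<pi> (lam x))"

end

theory Submission
  imports Defs
begin

text \<open>
  Write \<open>m\<close> for \<open>\<lambda> \<star> \<mu>\<close> and \<open>P\<close> for the Markov operator. The mean of \<open>f\<close> is obtained by averaging \<open>f\<close> along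
  the Markov chain: let \<open>A\<^sub>n f = (f + P f + \<dots> + P\<^bsup>n-1\<^esup> f) / n\<close>, and let \<open>F\<close> be a weak-* limit of the \<open>A\<^sub>n f\<close> in
  \<open>L\<^sup>\<infinity>(m)\<close> along a fixed filter \<open>U\<close> on the natural numbers along which all bounded real sequences
  converge. Since \<open>P (A\<^sub>n f) - A\<^sub>n f\<close> tends to zero and \<open>P\<close> is weak-* continuous (\<open>m\<close> being adapted), \<open>F\<close> is
  harmonic. As \<open>P\<close> is fiberwise Liouville, \<open>F\<close> is constant on almost every fiber of \<open>tgt\<close>, that is,
  \<open>F = \<phi> \<circ> tgt\<close> for some \<open>\<phi> \<in> L\<^sup>\<infinity>(\<mu>)\<close> (\<open>harmonic_factors_through_tgt\<close>). The mean sends \<open>f\<close> to \<open>\<phi>\<close>. It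
  is linear, positive and normalized because \<open>A\<^sub>n\<close> and limits along \<open>U\<close> are.

  For equivariance, \<open>f \<mapsto> \<theta> * f\<close> commutes with \<open>P\<close> by Fubini and the invariance of the transition
  probabilities (\<open>markov_op_conv_kernel_commute\<close>), hence with all \<open>A\<^sub>n\<close>. It is weak-* continuous because
  it comes from a kernel that preserves \<open>m\<close>-null sets (\<open>conv_kernel_null_preserving\<close>), a consequence of
  the quasi-invariance of \<open>\<mu>\<close>, the invariance of the Haar system and the absolute continuity of \<open>\<theta>\<close>.
  Therefore the limit belonging to \<open>\<theta> * f\<close> is \<open>\<theta> * (\<phi> \<circ> tgt) = (\<theta> * \<phi>) \<circ> tgt\<close>. The masses of \<open>\<theta>\<close> may be
  unbounded; \<open>\<theta>\<close> is first multiplied by a positive function of the base point that makes them at most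
  one, and since the mean commutes with multiplication by functions of the target, this factor can be
  divided out again.

  Weak-* compactness of bounded sequences (\<open>bounded_sequence_has_weak_limit\<close>) is obtained directly: the
  limits of \<open>\<integral>\<^bsub>A\<^esub> A\<^sub>n f dp\<close> along \<open>U\<close>, for a finite measure \<open>p\<close> equivalent to \<open>m\<close>, form a measure dominated by
  a multiple of \<open>p\<close>, and \<open>F\<close> is its Radon-Nikodym density. Pointwise limits along \<open>U\<close> would not do, as
  they need not be measurable.
\<close>

section \<open>Limits of all bounded sequences\<close>

text \<open>
  Such a filter assigns a limit to every bounded real sequence, linearly and positively, and agrees
  with the ordinary limit wherever that exists. It replaces the choice of convergent subsequences,
  which need not exist in the unit ball of \<open>L\<^sup>\<infinity>\<close> when \<open>L\<^sup>1\<close> is not separable.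
\<close>

definition generalized_limit :: "nat filter \<Rightarrow> bool" where
  "generalized_limit U \<longleftrightarrow> U \<noteq> bot \<and> U \<le> sequentially \<and>
     (\<forall>a :: nat \<Rightarrow> real. (\<exists>C. \<forall>n. \<bar>a n\<bar> \<le> C) \<longrightarrow> (\<exists>l. (a \<longlongrightarrow> l) U))"

text \<open>
  Zorn's lemma applies because the infimum of a chain of proper filters is proper: an event of the
  infimum is already an event of a member of the chain.
\<close>

lemma maximal_proper_filter_below:
  fixes F :: "'a filter"
  assumes "F \<noteq> bot"
  obtains U where "U \<noteq> bot" "U \<le> F" "\<And>V. V \<noteq> bot \<Longrightarrow> V \<le> U \<Longrightarrow> V = U"
proof -
  let ?A = "{V. V \<noteq> bot \<and> V \<le> F}"
  have "\<exists>U\<in>?A. \<forall>V\<in>?A. V \<le> U \<longrightarrow> V = U"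
  proof (rule predicate_Zorn)
    show "partial_order_on ?A (relation_of (\<lambda>V W. W \<le> V) ?A)"
      by (auto simp: partial_order_on_def preorder_on_def refl_on_def trans_def antisym_def
          relation_of_def)
  next
    fix C assume C: "C \<in> Chains (relation_of (\<lambda>V W. W \<le> V) ?A)"
    have mem: "V \<noteq> bot \<and> V \<le> F" if "V \<in> C" for V
      using C that by (auto simp: Chains_def relation_of_def)
    have tot: "V \<le> W \<or> W \<le> V" if "V \<in> C" "W \<in> C" for V W
      using C that by (auto simp: Chains_def relation_of_def)
    show "\<exists>u\<in>?A. \<forall>V\<in>C. u \<le> V"
    proof (cases "C = {}")
      case True
      then show ?thesis using assms by auto
    next
      case False
      have "eventually (\<lambda>_. False) (Inf C) \<longleftrightarrow> (\<exists>V\<in>C. eventually (\<lambda>_. False) V)"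
        using False tot by (intro eventually_Inf_base) (auto simp: le_inf_iff)
      then have "Inf C \<noteq> bot"
        using mem by (auto simp: trivial_limit_def)
      moreover have "Inf C \<le> F"
        using False mem by (meson Inf_lower2 ex_in_conv)
      ultimately show ?thesis
        by (auto intro!: bexI[of _ "Inf C"] Inf_lower)
    qed
  qed
  then obtain U where "U \<in> ?A" and max: "\<forall>V\<in>?A. V \<le> U \<longrightarrow> V = U" by blast
  then show ?thesis by (intro that[of U]) auto
qed

text \<open>
  A maximal proper filter \<open>U\<close> works. A bounded sequence \<open>a\<close> has a cluster point \<open>l\<close> along \<open>U\<close> by
  compactness; adding the events \<open>a n \<in> V\<close>, for \<open>V\<close> a neighbourhood of \<open>l\<close>, to \<open>U\<close> gives a proper
  filter, which by maximality is \<open>U\<close> again.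
\<close>

lemma generalized_limit_exists: "\<exists>U. generalized_limit U"
proof -
  obtain U :: "nat filter" where U: "U \<noteq> bot" "U \<le> sequentially"
    and max: "\<And>V. V \<noteq> bot \<Longrightarrow> V \<le> U \<Longrightarrow> V = U"
    using maximal_proper_filter_below[OF sequentially_bot] by metis
  have "\<exists>l. (a \<longlongrightarrow> l) U" if C: "\<And>n. \<bar>a n\<bar> \<le> C" for a :: "nat \<Rightarrow> real" and C
  proof -
    have "filtermap a U \<noteq> bot"
      using U by (simp add: filtermap_bot_iff)
    moreover have "eventually (\<lambda>y. y \<in> {-C..C}) (filtermap a U)"
      using C by (auto simp: eventually_filtermap abs_le_iff minus_le_iff intro!: always_eventually)
    ultimately obtain l where l: "inf (nhds l) (filtermap a U) \<noteq> bot"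
      using compact_Icc[of "-C" C] unfolding compact_filter by blast
    let ?V = "inf U (filtercomap a (nhds l))"
    have "?V \<noteq> bot"
    proof
      assume "?V = bot"
      then have "eventually (\<lambda>_. False) ?V" by simp
      then obtain Q R where Q: "eventually Q U" and R: "eventually R (nhds l)"
        and QR: "\<And>n. Q n \<Longrightarrow> R (a n) \<Longrightarrow> False"
        unfolding eventually_inf eventually_filtercomap by blast
      have "eventually (\<lambda>y. \<exists>n. Q n \<and> y = a n) (filtermap a U)"
        using Q by (auto simp: eventually_filtermap elim: eventually_mono)
      with R have "eventually (\<lambda>_. False) (inf (nhds l) (filtermap a U))"
        unfolding eventually_inf using QR by blast
      with l show False by (simp add: trivial_limit_def)
    qed
    then have "?V = U" by (intro max) auto
    then have "filtermap a U \<le> nhds l"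
      by (metis filtermap_le_iff_le_filtercomap inf_le2)
    then show ?thesis unfolding filterlim_def by blast
  qed
  with U show ?thesis unfolding generalized_limit_def by blast
qed

section \<open>Weak limits of bounded functions\<close>

text \<open>
  Boundedness is required at every point, not just almost everywhere, because such functions are
  integrated against individual measures of a kernel, which may be singular to \<open>M\<close>.
\<close>

definition bounded_measurable :: "'a measure \<Rightarrow> ('a \<Rightarrow> real) set" where
  "bounded_measurable M = {f \<in> borel_measurable M. \<exists>C. \<forall>x\<in>space M. \<bar>f x\<bar> \<le> C}"

text \<open>
  The positive cone of the predual of \<open>L\<^sup>\<infinity>(M)\<close>. Its elements are kept as measures instead of densities
  with respect to \<open>M\<close>, since kernels act on measures.
\<close>

definition finite_below :: "'a measure \<Rightarrow> 'a measure set" where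
  "finite_below M = {\<nu>. finite_measure \<nu> \<and> sets \<nu> = sets M \<and> absolutely_continuous M \<nu>}"

text \<open>
  Convergence in the weak-* topology of \<open>L\<^sup>\<infinity>(M)\<close>, along the filter \<open>U\<close>.
\<close>

definition weak_limit ::
  "nat filter \<Rightarrow> 'a measure \<Rightarrow> (nat \<Rightarrow> 'a \<Rightarrow> real) \<Rightarrow> ('a \<Rightarrow> real) \<Rightarrow> bool" where
  "weak_limit U M f F \<longleftrightarrow>
     (\<forall>\<nu>\<in>finite_below M. ((\<lambda>n. \<integral>x. f n x \<partial>\<nu>) \<longlongrightarrow> (\<integral>x. F x \<partial>\<nu>)) U)"

lemma bounded_measurableE:
  assumes "f \<in> bounded_measurable M"
  obtains C where "f \<in> borel_measurable M" "0 \<le> C" "\<And>x. x \<in> space M \<Longrightarrow> \<bar>f x\<bar> \<le> C"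
proof -
  obtain C where "f \<in> borel_measurable M" "\<And>x. x \<in> space M \<Longrightarrow> \<bar>f x\<bar> \<le> C"
    using assms by (auto simp: bounded_measurable_def)
  then show ?thesis
    by (intro that[of "max 0 C"]) (auto simp: le_max_iff_disj)
qed

lemma bounded_measurableI:
  "f \<in> borel_measurable M \<Longrightarrow> (\<And>x. x \<in> space M \<Longrightarrow> \<bar>f x\<bar> \<le> C) \<Longrightarrow> f \<in> bounded_measurable M"
  by (auto simp: bounded_measurable_def)

lemma bounded_measurable_measurable: "f \<in> bounded_measurable M \<Longrightarrow> f \<in> borel_measurable M"
  by (simp add: bounded_measurable_def)

lemma bounded_measurable_const: "(\<lambda>_. c) \<in> bounded_measurable M"
  by (intro bounded_measurableI[of _ _ "\<bar>c\<bar>"]) auto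

lemma bounded_measurable_add:
  assumes "f \<in> bounded_measurable M" "g \<in> bounded_measurable M"
  shows "(\<lambda>x. f x + g x) \<in> bounded_measurable M"
proof -
  obtain C D where "f \<in> borel_measurable M" "\<And>x. x \<in> space M \<Longrightarrow> \<bar>f x\<bar> \<le> C"
    "g \<in> borel_measurable M" "\<And>x. x \<in> space M \<Longrightarrow> \<bar>g x\<bar> \<le> D"
    using assms by (metis bounded_measurableE)
  then show ?thesis
    by (intro bounded_measurableI[of _ _ "C + D"])
      (auto intro!: order_trans[OF abs_triangle_ineq] add_mono)
qed

lemma bounded_measurable_mult:
  assumes "f \<in> bounded_measurable M" "g \<in> bounded_measurable M"
  shows "(\<lambda>x. f x * g x) \<in> bounded_measurable M"
proof -
  obtain C D where "f \<in> borel_measurable M" "\<And>x. x \<in> space M \<Longrightarrow> \<bar>f x\<bar> \<le> C" "0 \<le> C"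
    "g \<in> borel_measurable M" "\<And>x. x \<in> space M \<Longrightarrow> \<bar>g x\<bar> \<le> D" "0 \<le> D"
    using assms by (metis bounded_measurableE)
  then show ?thesis
    by (intro bounded_measurableI[of _ _ "C * D"]) (auto simp: abs_mult intro!: mult_mono)
qed

lemma bounded_measurable_comp:
  assumes "f \<in> bounded_measurable N" "h \<in> measurable M N"
  shows "(\<lambda>x. f (h x)) \<in> bounded_measurable M"
proof -
  obtain C where f: "f \<in> borel_measurable N" "\<And>x. x \<in> space N \<Longrightarrow> \<bar>f x\<bar> \<le> C"
    using assms by (metis bounded_measurableE)
  show ?thesis
    by (rule bounded_measurableI[of _ _ C])
      (use f assms measurable_space[OF assms(2)] in \<open>auto intro: measurable_compose\<close>)
qed

text \<open>
  Truncation at the essential bound.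
\<close>

lemma Linf_bounded_representative:
  assumes "f \<in> Linf M"
  obtains g where "g \<in> bounded_measurable M" "AE x in M. f x = g x"
proof -
  obtain C where f: "f \<in> borel_measurable M" and C: "AE x in M. \<bar>f x\<bar> \<le> C"
    using assms by (auto simp: Linf_def)
  let ?g = "\<lambda>x. max (- \<bar>C\<bar>) (min \<bar>C\<bar> (f x))"
  show ?thesis
  proof (rule that[of ?g])
    show "?g \<in> bounded_measurable M"
      using f by (intro bounded_measurableI[of _ _ "\<bar>C\<bar>"]) auto
    show "AE x in M. f x = ?g x"
      using C by eventually_elim auto
  qed
qed

lemma bounded_measurable_subset_Linf: "bounded_measurable M \<subseteq> Linf M"
  by (auto simp: bounded_measurable_def Linf_def)

lemma finite_belowD:
  assumes "\<nu> \<in> finite_below M"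
  shows "finite_measure \<nu>" "sets \<nu> = sets M" "space \<nu> = space M"
    "AE x in M. P x \<Longrightarrow> AE x in \<nu>. P x"
  using assms absolutely_continuous_AE[of \<nu> M P] sets_eq_imp_space_eq[of \<nu> M]
  by (auto simp: finite_below_def)

lemma bounded_measurable_integrable:
  assumes "\<nu> \<in> finite_below M" "f \<in> bounded_measurable M"
  shows "integrable \<nu> f"
proof -
  interpret finite_measure \<nu> using finite_belowD(1)[OF assms(1)] .
  obtain C where "f \<in> borel_measurable M" "\<And>x. x \<in> space M \<Longrightarrow> \<bar>f x\<bar> \<le> C"
    using assms(2) by (metis bounded_measurableE)
  then show ?thesis
    using finite_belowD(2,3)[OF assms(1)]
    by (intro integrable_const_bound[of _ C]) (auto cong: measurable_cong_sets)
qed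

lemma finite_below_density:
  assumes \<nu>: "\<nu> \<in> finite_below M" and f: "f \<in> bounded_measurable M"
    and nn: "\<And>x. x \<in> space M \<Longrightarrow> 0 \<le> f x"
  shows "density \<nu> (\<lambda>x. ennreal (f x)) \<in> finite_below M"
proof -
  interpret finite_measure \<nu> using finite_belowD(1)[OF \<nu>] .
  note s = finite_belowD(2,3)[OF \<nu>]
  have fm: "f \<in> borel_measurable \<nu>"
    using bounded_measurable_measurable[OF f] s by (simp cong: measurable_cong_sets)
  have "(\<integral>\<^sup>+x. ennreal (f x) \<partial>\<nu>) < \<infinity>"
    using bounded_measurable_integrable[OF \<nu> f] nn s
    by (subst nn_integral_eq_integral) auto
  then have "finite_measure (density \<nu> (\<lambda>x. ennreal (f x)))"
    using fm by (intro finite_measureI) (auto simp: emeasure_density cong: nn_integral_cong)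
  moreover have "absolutely_continuous M (density \<nu> (\<lambda>x. ennreal (f x)))"
  proof -
    have "absolutely_continuous \<nu> (density \<nu> (\<lambda>x. ennreal (f x)))"
      using fm by (intro absolutely_continuousI_density) auto
    with \<nu> show ?thesis by (auto simp: absolutely_continuous_def finite_below_def)
  qed
  ultimately show ?thesis using s by (simp add: finite_below_def)
qed

lemma integral_finite_below_density:
  assumes \<nu>: "\<nu> \<in> finite_below M" and f: "f \<in> bounded_measurable M" and h: "h \<in> bounded_measurable M"
    and nn: "\<And>x. x \<in> space M \<Longrightarrow> 0 \<le> f x"
  shows "(\<integral>x. h x \<partial>density \<nu> (\<lambda>x. ennreal (f x))) = (\<integral>x. f x * h x \<partial>\<nu>)"
proof -
  note s = finite_belowD(2,3)[OF \<nu>]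
  show ?thesis
    using bounded_measurable_measurable[OF f] bounded_measurable_measurable[OF h] s nn
    by (subst integral_real_density) (auto cong: measurable_cong_sets intro!: AE_I2)
qed

lemma (in sigma_finite_measure) equivalent_finite_measure:
  obtains p where "p \<in> finite_below M" "absolutely_continuous p M"
proof -
  obtain h where h: "h \<in> borel_measurable M" "integral\<^sup>N M h \<noteq> \<infinity>"
    and pos: "\<And>x. x \<in> space M \<Longrightarrow> 0 < h x"
    using Ex_finite_integrable_function by blast
  show ?thesis
  proof (rule that[of "density M h"])
    have "finite_measure (density M h)"
      using h by (intro finite_measureI) (auto simp: emeasure_density cong: nn_integral_cong)
    then show "density M h \<in> finite_below M"
      using h by (auto simp: finite_below_def intro: absolutely_continuousI_density)
    show "absolutely_continuous (density M h) M"
    proof (unfold absolutely_continuous_def, rule subsetI)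
      fix N assume "N \<in> null_sets (density M h)"
      then have N: "N \<in> sets M" and ae: "AE x in M. x \<in> N \<longrightarrow> h x = 0"
        using h by (auto simp: null_sets_density_iff)
      have "AE x in M. x \<notin> N"
        using ae AE_space by eventually_elim (use pos in force)
      with N show "N \<in> null_sets M" by (simp add: AE_iff_null_sets)
    qed
  qed
qed

text \<open>
  The restriction to \<open>{F < 0}\<close> of a finite measure equivalent to \<open>M\<close> is one of the test measures; the
  integral of \<open>F\<close> against it can be nonnegative only if it vanishes.
\<close>

lemma (in sigma_finite_measure) AE_nonneg_if_integral_nonneg:
  assumes F: "F \<in> bounded_measurable M" and nn: "\<And>\<nu>. \<nu> \<in> finite_below M \<Longrightarrow> 0 \<le> (\<integral>x. F x \<partial>\<nu>)"
  shows "AE x in M. 0 \<le> F x"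
proof -
  obtain p where p: "p \<in> finite_below M" and Mp: "absolutely_continuous p M"
    using equivalent_finite_measure .
  note s = finite_belowD(2,3)[OF p]
  note Fm = bounded_measurable_measurable[OF F]
  let ?i = "\<lambda>x. if F x < 0 then 1 else 0 :: real"
  have i: "?i \<in> bounded_measurable M"
    using Fm by (intro bounded_measurableI[of _ _ 1]) auto
  let ?n = "\<lambda>x. - (?i x * F x)"
  have n: "?n \<in> bounded_measurable M"
    using bounded_measurable_mult[OF bounded_measurable_const[of "-1"]
      bounded_measurable_mult[OF i F]] by (simp cong: if_cong)
  have "0 \<le> (\<integral>x. ?i x * F x \<partial>p)"
    using nn[OF finite_below_density[OF p i]] integral_finite_below_density[OF p i F] by simp
  moreover have "0 \<le> (\<integral>x. ?n x \<partial>p)"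
    by (intro integral_nonneg_AE) auto
  moreover have "(\<integral>x. ?n x \<partial>p) = - (\<integral>x. ?i x * F x \<partial>p)"
    by (rule integral_minus)
  ultimately have "(\<integral>x. ?n x \<partial>p) = 0" by linarith
  then have "AE x in p. ?n x = 0"
    using bounded_measurable_integrable[OF p n]
    by (subst (asm) integral_nonneg_eq_0_iff_AE) auto
  then have "AE x in p. 0 \<le> F x"
    by eventually_elim (auto split: if_splits)
  then show ?thesis
    using absolutely_continuous_AE[OF _ Mp] s by auto
qed

text \<open>
  Applied in both directions this also gives uniqueness of weak limits.
\<close>

lemma (in sigma_finite_measure) weak_limit_mono:
  assumes U: "generalized_limit U"
    and f: "weak_limit U M f F" "F \<in> bounded_measurable M" "\<And>n. f n \<in> bounded_measurable M"
    and g: "weak_limit U M g G" "G \<in> bounded_measurable M" "\<And>n. g n \<in> bounded_measurable M"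
    and le: "\<And>n. AE x in M. f n x \<le> g n x"
  shows "AE x in M. F x \<le> G x"
proof -
  have "AE x in M. 0 \<le> G x + (-1) * F x"
  proof (rule AE_nonneg_if_integral_nonneg)
    show "(\<lambda>x. G x + (-1) * F x) \<in> bounded_measurable M"
      using f g by (intro bounded_measurable_add bounded_measurable_mult bounded_measurable_const)
  next
    fix \<nu> assume \<nu>: "\<nu> \<in> finite_below M"
    note int = bounded_measurable_integrable[OF \<nu>]
    have "(\<integral>x. F x \<partial>\<nu>) \<le> (\<integral>x. G x \<partial>\<nu>)"
    proof (rule tendsto_le)
      show "U \<noteq> bot" using U by (simp add: generalized_limit_def)
      show "((\<lambda>n. \<integral>x. f n x \<partial>\<nu>) \<longlongrightarrow> (\<integral>x. F x \<partial>\<nu>)) U" "((\<lambda>n. \<integral>x. g n x \<partial>\<nu>) \<longlongrightarrow> (\<integral>x. G x \<partial>\<nu>)) U"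
        using f g \<nu> by (auto simp: weak_limit_def)
      show "\<forall>\<^sub>F n in U. (\<integral>x. f n x \<partial>\<nu>) \<le> (\<integral>x. g n x \<partial>\<nu>)"
        by (intro always_eventually allI integral_mono_AE int f g finite_belowD(4)[OF \<nu> le])
    qed
    moreover have "(\<integral>x. G x + (-1) * F x \<partial>\<nu>) = (\<integral>x. G x \<partial>\<nu>) - (\<integral>x. F x \<partial>\<nu>)"
      using f g by (simp add: int)
    ultimately show "0 \<le> (\<integral>x. G x + (-1) * F x \<partial>\<nu>)" by simp
  qed
  then show ?thesis by eventually_elim simp
qed

text \<open>
  The limit \<open>L A\<close> of \<open>\<integral>\<^bsub>A\<^esub> f n\<close> is finitely additive in \<open>A\<close>, and \<open>0 \<le> L A \<le> C * measure M A\<close>. The upper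
  bound makes \<open>L\<close> continuous at the empty set, hence a measure, and absolutely continuous; its
  Radon-Nikodym density is at most \<open>C\<close>.
\<close>

lemma (in finite_measure) limit_of_integrals_is_density:
  assumes U: "generalized_limit U"
    and f: "\<And>n. f n \<in> borel_measurable M" "\<And>n x. x \<in> space M \<Longrightarrow> 0 \<le> f n x"
      "\<And>n x. x \<in> space M \<Longrightarrow> f n x \<le> C"
  obtains F where "F \<in> bounded_measurable M"
    "\<And>A. A \<in> sets M \<Longrightarrow> ((\<lambda>n. \<integral>x. indicator A x * f n x \<partial>M) \<longlongrightarrow> (\<integral>x. indicator A x * F x \<partial>M)) U"
proof -
  have C: "0 \<le> C" if "space M \<noteq> {}"
    using f(2)[of _ 0] f(3)[of _ 0] that by (meson ex_in_conv order_trans)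
  have int: "integrable M (f n)" for n
    using f by (intro integrable_const_bound[of _ C] AE_I2) (simp_all add: abs_of_nonneg)
  have intA: "integrable M (\<lambda>x. indicator A x * f n x)" if "A \<in> sets M" for A n
    using integrable_mult_indicator[OF that int[of n]] by simp
  define I where "I = (\<lambda>A n. \<integral>x. indicator A x * f n x \<partial>M)"
  have I0: "0 \<le> I A n" for A n
    unfolding I_def using f by (intro integral_nonneg_AE AE_I2) auto
  have I1: "I A n \<le> C * measure M A" if "A \<in> sets M" for A n
  proof -
    have "I A n \<le> (\<integral>x. indicator A x * C \<partial>M)"
      unfolding I_def using f that
      by (intro integral_mono intA that integrable_mult_left integrable_real_indicator)
        (auto simp: indicator_def less_top[symmetric])
    then show ?thesis using that by (simp add: mult.commute)
  qed
  define L where "L = (\<lambda>A. Lim U (I A))"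
  have Ubot: "U \<noteq> bot" using U by (simp add: generalized_limit_def)
  have lim: "(I A \<longlongrightarrow> L A) U" if "A \<in> sets M" for A
  proof -
    have "\<bar>I A n\<bar> \<le> C * measure M A" for n using I0[of A n] I1[OF that] by simp
    then obtain l where "(I A \<longlongrightarrow> l) U" using U unfolding generalized_limit_def by blast
    with Ubot show ?thesis by (simp add: L_def tendsto_Lim)
  qed
  have L0: "0 \<le> L A" if "A \<in> sets M" for A
    using tendsto_lowerbound[OF lim[OF that]] I0 Ubot by simp
  have L1: "L A \<le> C * measure M A" if "A \<in> sets M" for A
    using tendsto_upperbound[OF lim[OF that]] I1[OF that] Ubot by simp
  have Iadd: "I (A \<union> B) n = I A n + I B n" if "A \<in> sets M" "B \<in> sets M" "A \<inter> B = {}" for A B n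
  proof -
    have "I (A \<union> B) n = (\<integral>x. indicator A x * f n x + indicator B x * f n x \<partial>M)"
      unfolding I_def using that(3)
      by (intro Bochner_Integration.integral_cong) (auto simp: indicator_def)
    also have "\<dots> = I A n + I B n"
      unfolding I_def by (intro Bochner_Integration.integral_add intA that)
    finally show ?thesis .
  qed
  have Ladd: "L (A \<union> B) = L A + L B" if "A \<in> sets M" "B \<in> sets M" "A \<inter> B = {}" for A B
  proof -
    have "(I (A \<union> B) \<longlongrightarrow> L A + L B) U"
      using tendsto_add[OF lim[OF that(1)] lim[OF that(2)]] unfolding Iadd[OF that, symmetric] .
    with lim[of "A \<union> B"] that Ubot show ?thesis by (blast intro: tendsto_unique)
  qed
  have "I {} = (\<lambda>_. 0)" by (auto simp: I_def)
  then have Lempty: "L {} = 0"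
    using L1[of "{}"] L0[of "{}"] by simp
  have "countably_additive (sets M) (\<lambda>A. ennreal (L A))"
  proof (rule ring_of_sets.empty_continuous_imp_countably_additive)
    show "ring_of_sets (space M) (sets M)" by unfold_locales
    show "positive (sets M) (\<lambda>A. ennreal (L A))" using Lempty by (simp add: positive_def)
    show "additive (sets M) (\<lambda>A. ennreal (L A))"
      using Ladd L0 by (auto simp: additive_def ennreal_plus[symmetric] simp del: ennreal_plus)
    show "\<forall>A\<in>sets M. ennreal (L A) \<noteq> \<infinity>" by simp
  next
    fix A :: "nat \<Rightarrow> 'a set" assume A: "range A \<subseteq> sets M" "decseq A" "\<Inter> (range A) = {}"
    have "(\<lambda>i. measure M (A i)) \<longlonglongrightarrow> 0"
      using finite_Lim_measure_decseq[OF A(1,2)] A(3) by simp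
    from tendsto_mult_right_zero[OF this, of C] have "(\<lambda>i. C * measure M (A i)) \<longlonglongrightarrow> 0" .
    moreover have Ai: "A i \<in> sets M" for i
      using A(1) by (rule subsetD) (rule rangeI)
    ultimately have "(\<lambda>i. L (A i)) \<longlonglongrightarrow> 0"
      using L0[OF Ai] L1[OF Ai]
      by - (rule tendsto_sandwich[of "\<lambda>_. 0" "\<lambda>i. L (A i)" sequentially], simp_all)
    from tendsto_ennrealI[OF this] show "(\<lambda>i. ennreal (L (A i))) \<longlonglongrightarrow> 0"
      by simp
  qed
  then have ms: "measure_space (space M) (sets M) (\<lambda>A. ennreal (L A))"
    using Lempty by (simp add: measure_space_def positive_def sets.sigma_algebra_axioms)
  define Q where "Q = measure_of (space M) (sets M) (\<lambda>A. ennreal (L A))"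
  have sQ: "sets Q = sets M" "space Q = space M"
    by (simp_all add: Q_def)
  have eQ: "emeasure Q A = ennreal (L A)" if "A \<in> sets M" for A
    unfolding Q_def using that ms
    by (intro emeasure_measure_of_sigma) (auto simp: measure_space_def)
  have "absolutely_continuous M Q"
  proof (unfold absolutely_continuous_def, rule subsetI)
    fix N assume "N \<in> null_sets M"
    then show "N \<in> null_sets Q"
      using L1[of N] L0[of N] eQ[of N] sQ by (auto simp: null_sets_def measure_def)
  qed
  then obtain h where h: "h \<in> borel_measurable M" "density M h = Q"
    using Radon_Nikodym sQ by blast
  have hL: "(\<integral>\<^sup>+x. h x * indicator A x \<partial>M) = ennreal (L A)" if "A \<in> sets M" for A
    using emeasure_density[OF h(1) that] h(2) eQ[OF that] by simp
  \<comment> \<open>On the set where the density exceeds \<open>C\<close> the excess integrates to zero.\<close>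
  have hC: "AE x in M. h x \<le> ennreal C"
  proof -
    let ?N = "{x \<in> space M. ennreal C < h x}"
    have N: "?N \<in> sets M" using h(1) by measurable
    have split: "h x * indicator ?N x = ennreal C * indicator ?N x + (h x - ennreal C) * indicator ?N x"
      for x
      by (auto simp: indicator_def add_diff_inverse_ennreal less_imp_le)
    have "(\<integral>\<^sup>+x. ennreal C * indicator ?N x \<partial>M) + (\<integral>\<^sup>+x. (h x - ennreal C) * indicator ?N x \<partial>M)
        = ennreal (L ?N)"
      using N h(1) by (subst nn_integral_add[symmetric]) (auto simp: hL[OF N, symmetric] split)
    also have "\<dots> \<le> ennreal (C * measure M ?N)" using L1[OF N] by (rule ennreal_leI)
    also have "\<dots> = ennreal C * emeasure M ?N"
      using C by (cases "space M = {}") (auto simp: emeasure_eq_measure ennreal_mult)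
    finally have "ennreal C * emeasure M ?N + (\<integral>\<^sup>+x. (h x - ennreal C) * indicator ?N x \<partial>M)
        \<le> ennreal C * emeasure M ?N + 0"
      using N by (simp add: nn_integral_cmult_indicator)
    then have "(\<integral>\<^sup>+x. (h x - ennreal C) * indicator ?N x \<partial>M) = 0"
      by (simp add: emeasure_eq_measure ennreal_mult_eq_top_iff ennreal_add_left_cancel_le)
    then have "AE x in M. (h x - ennreal C) * indicator ?N x = 0"
      using h(1) N by (subst (asm) nn_integral_0_iff_AE) auto
    then show ?thesis
      using AE_space
    proof eventually_elim
      case (elim x)
      then show ?case
        by (cases "ennreal C < h x") (auto simp: diff_eq_0_iff_ennreal)
    qed
  qed
  \<comment> \<open>Cutting off at \<open>C\<close> changes the density on a null set only and makes it bounded everywhere.\<close>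
  let ?F = "\<lambda>x. enn2real (min (h x) (ennreal C))"
  have Fb: "?F \<in> bounded_measurable M"
    using h(1) by (intro bounded_measurableI[of _ _ "\<bar>C\<bar>"]) (auto intro!: enn2real_leI min.coboundedI2 ennreal_leI)
  show ?thesis
  proof (rule that[OF Fb])
    fix A assume A: "A \<in> sets M"
    have "(\<integral>x. indicator A x * ?F x \<partial>M) = enn2real (\<integral>\<^sup>+x. ennreal (indicator A x * ?F x) \<partial>M)"
      using h(1) A by (intro integral_eq_nn_integral) auto
    also have "(\<integral>\<^sup>+x. ennreal (indicator A x * ?F x) \<partial>M) = (\<integral>\<^sup>+x. h x * indicator A x \<partial>M)"
    proof (rule nn_integral_cong_AE)
      show "AE x in M. ennreal (indicator A x * ?F x) = h x * indicator A x"
        using hC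
      proof eventually_elim
        case (elim x)
        then have "h x < top" using ennreal_less_top le_less_trans by blast
        with elim show ?case by (auto simp: indicator_def min_def)
      qed
    qed
    finally have "(\<integral>x. indicator A x * ?F x \<partial>M) = L A"
      using hL[OF A] L0[OF A] by simp
    with lim[OF A] show "((\<lambda>n. \<integral>x. indicator A x * f n x \<partial>M) \<longlongrightarrow> (\<integral>x. indicator A x * ?F x \<partial>M)) U"
      by (simp add: I_def)
  qed
qed

text \<open>
  By linearity the limit relation passes from indicators to simple functions, and it is stable under
  \<open>L\<^sup>1\<close>-limits of the test function because the sequence is uniformly bounded.
\<close>

lemma (in finite_measure) integral_limit_against_integrable:
  fixes g :: "nat \<Rightarrow> 'a \<Rightarrow> real" and G :: "'a \<Rightarrow> real"
  assumes g: "\<And>n. g n \<in> borel_measurable M" "\<And>n x. x \<in> space M \<Longrightarrow> \<bar>g n x\<bar> \<le> B"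
    and G: "G \<in> borel_measurable M" "\<And>x. x \<in> space M \<Longrightarrow> \<bar>G x\<bar> \<le> B"
    and lim: "\<And>A. A \<in> sets M \<Longrightarrow>
      ((\<lambda>n. \<integral>x. indicator A x * g n x \<partial>M) \<longlongrightarrow> (\<integral>x. indicator A x * G x \<partial>M)) U"
    and k: "integrable M k"
  shows "((\<lambda>n. \<integral>x. k x * g n x \<partial>M) \<longlongrightarrow> (\<integral>x. k x * G x \<partial>M)) U"
proof -
  have int: "integrable M (\<lambda>x. l x * u x)"
    if "integrable M l" "u \<in> borel_measurable M" "\<And>x. x \<in> space M \<Longrightarrow> \<bar>u x\<bar> \<le> B"
    for l u :: "'a \<Rightarrow> real"
  proof (rule Bochner_Integration.integrable_bound)
    show "integrable M (\<lambda>x. B * l x)" using that by simp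
    show "AE x in M. norm (l x * u x) \<le> norm (B * l x)"
    proof (rule AE_I2)
      fix x assume "x \<in> space M"
      then have "\<bar>u x\<bar> \<le> \<bar>B\<bar>" using that(3) by fastforce
      then have "\<bar>u x\<bar> * \<bar>l x\<bar> \<le> \<bar>B\<bar> * \<bar>l x\<bar>" by (rule mult_right_mono) simp
      then show "norm (l x * u x) \<le> norm (B * l x)" by (simp add: abs_mult mult.commute)
    qed
  qed (use that in auto)
  show ?thesis
    using k
  proof (induction k rule: integrable_induct)
    case (base A c)
    from tendsto_mult[OF tendsto_const[of c] lim[OF base(1)]]
    show ?case by (simp add: mult.commute mult.left_commute)
  next
    case (add f h)
    have "((\<lambda>n. (\<integral>x. f x * g n x \<partial>M) + (\<integral>x. h x * g n x \<partial>M)) \<longlongrightarrow>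
        (\<integral>x. f x * G x \<partial>M) + (\<integral>x. h x * G x \<partial>M)) U"
      using add by (intro tendsto_add)
    moreover have "(\<integral>x. (f x + h x) * u x \<partial>M) = (\<integral>x. f x * u x \<partial>M) + (\<integral>x. h x * u x \<partial>M)"
      if "u \<in> borel_measurable M" "\<And>x. x \<in> space M \<Longrightarrow> \<bar>u x\<bar> \<le> B" for u
      unfolding distrib_right by (intro Bochner_Integration.integral_add int add that)
    ultimately show ?case using g G by simp
  next
    case (lim k s)
    define d where "d = (\<lambda>i. \<integral>x. \<bar>s i x - k x\<bar> \<partial>M)"
    have approx: "\<bar>(\<integral>x. s i x * u x \<partial>M) - (\<integral>x. k x * u x \<partial>M)\<bar> \<le> \<bar>B\<bar> * d i"
      if u: "u \<in> borel_measurable M" "\<And>x. x \<in> space M \<Longrightarrow> \<bar>u x\<bar> \<le> B" for u i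
    proof -
      have "(\<integral>x. s i x * u x \<partial>M) - (\<integral>x. k x * u x \<partial>M) = (\<integral>x. (s i x - k x) * u x \<partial>M)"
        unfolding left_diff_distrib
        by (intro Bochner_Integration.integral_diff[symmetric] int lim u)
      also have "\<bar>\<dots>\<bar> \<le> (\<integral>x. \<bar>(s i x - k x) * u x\<bar> \<partial>M)"
        by (rule integral_abs_bound)
      also have "\<dots> \<le> (\<integral>x. \<bar>B\<bar> * \<bar>s i x - k x\<bar> \<partial>M)"
      proof (rule integral_mono)
        show "integrable M (\<lambda>x. \<bar>(s i x - k x) * u x\<bar>)"
          by (intro integrable_abs int Bochner_Integration.integrable_diff lim u)
        show "integrable M (\<lambda>x. \<bar>B\<bar> * \<bar>s i x - k x\<bar>)"
          by (intro integrable_mult_right integrable_abs Bochner_Integration.integrable_diff lim)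
        fix x assume "x \<in> space M"
        then have "\<bar>u x\<bar> \<le> \<bar>B\<bar>" using u(2) by fastforce
        then have "\<bar>u x\<bar> * \<bar>s i x - k x\<bar> \<le> \<bar>B\<bar> * \<bar>s i x - k x\<bar>" by (rule mult_right_mono) simp
        then show "\<bar>(s i x - k x) * u x\<bar> \<le> \<bar>B\<bar> * \<bar>s i x - k x\<bar>"
          by (simp add: abs_mult mult.commute)
      qed
      finally show ?thesis by (simp add: d_def)
    qed
    have "(\<lambda>i. \<integral>x. \<bar>s i x - k x\<bar> \<partial>M) \<longlonglongrightarrow> (\<integral>x. 0 \<partial>M)"
    proof (rule integral_dominated_convergence[where w = "\<lambda>x. 3 * \<bar>k x\<bar>"])
      show "AE x in M. (\<lambda>i. \<bar>s i x - k x\<bar>) \<longlonglongrightarrow> 0"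
        by (intro AE_I2 tendsto_rabs_zero LIM_zero lim.hyps(2))
      show "AE x in M. norm \<bar>s i x - k x\<bar> \<le> 3 * \<bar>k x\<bar>" for i
        using lim.hyps(3) by (intro AE_I2) (smt (verit) real_norm_def)
    qed (use lim in auto)
    from tendsto_mult_right_zero[OF this[simplified], of "\<bar>B\<bar>"]
    have d0: "(\<lambda>i. \<bar>B\<bar> * d i) \<longlonglongrightarrow> 0" by (simp add: d_def)
    show ?case
    proof (rule tendstoI)
      fix e :: real assume e: "0 < e"
      obtain i where i: "\<bar>B\<bar> * d i < e / 3"
        using order_tendstoD(2)[OF d0, of "e / 3"] e
        by (auto simp: eventually_sequentially)
      have "\<forall>\<^sub>F n in U. dist (\<integral>x. s i x * g n x \<partial>M) (\<integral>x. s i x * G x \<partial>M) < e / 3"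
        using tendstoD[OF lim.IH[of i], of "e / 3"] e by simp
      then show "\<forall>\<^sub>F n in U. dist (\<integral>x. k x * g n x \<partial>M) (\<integral>x. k x * G x \<partial>M) < e"
      proof eventually_elim
        case (elim n)
        have "\<bar>(\<integral>x. s i x * g n x \<partial>M) - (\<integral>x. k x * g n x \<partial>M)\<bar> < e / 3"
             "\<bar>(\<integral>x. s i x * G x \<partial>M) - (\<integral>x. k x * G x \<partial>M)\<bar> < e / 3"
          using approx[of "g n" i] approx[of G i] g G i by (auto intro: le_less_trans)
        with elim show ?case unfolding dist_real_def by linarith
      qed
    qed
  qed
qed

text \<open>
  Weak-* compactness of balls in \<open>L\<^sup>\<infinity>(M)\<close>. Any test measure has an integrable density with respect to a
  fixed finite measure equivalent to \<open>M\<close>, so it suffices to find a limit against the restrictions of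
  that measure to measurable sets.
\<close>

lemma (in sigma_finite_measure) bounded_sequence_has_weak_limit:
  assumes U: "generalized_limit U"
    and f: "\<And>n. f n \<in> borel_measurable M" "\<And>n x. x \<in> space M \<Longrightarrow> \<bar>f n x\<bar> \<le> C"
  obtains F where "F \<in> bounded_measurable M" "weak_limit U M f F"
proof -
  obtain p where p: "p \<in> finite_below M" and Mp: "absolutely_continuous p M"
    using equivalent_finite_measure .
  note s = finite_belowD(2,3)[OF p]
  interpret p: finite_measure p using finite_belowD(1)[OF p] .
  have fp: "f n \<in> borel_measurable p" for n
    using f(1)[of n] s by (simp cong: measurable_cong_sets)
  \<comment> \<open>Adding \<open>C\<close> makes the sequence nonnegative, so that its limit functional is a measure.\<close>
  have "(\<lambda>x. f n x + C) \<in> borel_measurable p" for n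
    using fp by simp
  moreover have "0 \<le> f n x + C" "f n x + C \<le> 2 * C" if "x \<in> space p" for n x
    using f(2)[of x n] that s by auto
  ultimately obtain H where H: "H \<in> bounded_measurable p"
    and lim: "\<And>A. A \<in> sets p \<Longrightarrow>
      ((\<lambda>n. \<integral>x. indicator A x * (f n x + C) \<partial>p) \<longlongrightarrow> (\<integral>x. indicator A x * H x \<partial>p)) U"
    using p.limit_of_integrals_is_density[OF U, of "\<lambda>n x. f n x + C" "2 * C"] by blast
  obtain D where D: "H \<in> borel_measurable p" "0 \<le> D" "\<And>x. x \<in> space p \<Longrightarrow> \<bar>H x\<bar> \<le> D"
    using bounded_measurableE[OF H] by blast
  let ?F = "\<lambda>x. H x + - C"
  have Fb: "?F \<in> bounded_measurable M"
    using bounded_measurable_add[OF H bounded_measurable_const[of "-C"]] s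
    by (simp add: bounded_measurable_def cong: measurable_cong_sets)
  have "weak_limit U M f ?F"
    unfolding weak_limit_def
  proof
    fix \<nu> assume \<nu>: "\<nu> \<in> finite_below M"
    interpret n: finite_measure \<nu> using finite_belowD(1)[OF \<nu>] .
    note s' = finite_belowD(2,3)[OF \<nu>]
    have "absolutely_continuous p \<nu>"
      using \<nu> Mp by (auto simp: finite_below_def absolutely_continuous_def)
    then obtain k where k: "k \<in> borel_measurable p" "density p k = \<nu>"
      using p.Radon_Nikodym[of \<nu>] s s' by auto
    have fin: "(\<integral>\<^sup>+x. k x \<partial>p) < \<infinity>"
    proof -
      have "(\<integral>\<^sup>+x. k x \<partial>p) = emeasure \<nu> (space p)"
        using k by (simp add: emeasure_density k(2)[symmetric] cong: nn_integral_cong)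
      also have "\<dots> < \<infinity>" by (simp add: n.emeasure_finite less_top[symmetric])
      finally show ?thesis .
    qed
    let ?k = "\<lambda>x. enn2real (k x)"
    have ae: "AE x in p. k x = ennreal (?k x)"
      using nn_integral_PInf_AE[OF k(1)] fin by (auto elim!: eventually_mono simp: less_top)
    then have \<nu>': "\<nu> = density p (\<lambda>x. ennreal (?k x))"
      using k by (subst k(2)[symmetric]) (auto intro!: density_cong)
    have int: "integrable p ?k"
      using k(1) fin nn_integral_cong_AE[OF ae]
      by (intro integrableI_nonneg) auto
    have dens: "(\<integral>x. u x \<partial>\<nu>) = (\<integral>x. ?k x * u x \<partial>p)" if "u \<in> borel_measurable p" for u
      unfolding \<nu>' using that k(1) by (intro integral_real_density) auto
    have "((\<lambda>n. \<integral>x. ?k x * (f n x + C) \<partial>p) \<longlongrightarrow> (\<integral>x. ?k x * H x \<partial>p)) U"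
    proof (rule p.integral_limit_against_integrable[OF _ _ _ _ lim int])
      show "\<bar>f n x + C\<bar> \<le> max D (2 * C)" if "x \<in> space p" for n x
        using f(2)[of x n] that s by auto
      show "\<bar>H x\<bar> \<le> max D (2 * C)" if "x \<in> space p" for x
        using D(3)[OF that] by auto
    qed (use fp D in auto)
    then have "((\<lambda>n. \<integral>x. f n x + C \<partial>\<nu>) \<longlongrightarrow> (\<integral>x. H x \<partial>\<nu>)) U"
      using dens fp D(1) by simp
    from tendsto_diff[OF this tendsto_const[of "\<integral>x. C \<partial>\<nu>"]]
    have "((\<lambda>n. (\<integral>x. f n x + C \<partial>\<nu>) - (\<integral>x. C \<partial>\<nu>)) \<longlongrightarrow> (\<integral>x. H x \<partial>\<nu>) - (\<integral>x. C \<partial>\<nu>)) U" .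
    moreover have "(\<integral>x. f n x + C \<partial>\<nu>) - (\<integral>x. C \<partial>\<nu>) = (\<integral>x. f n x \<partial>\<nu>)" for n
    proof -
      have "integrable \<nu> (f n)"
        using f by (intro bounded_measurable_integrable[OF \<nu>] bounded_measurableI)
      then show ?thesis by simp
    qed
    moreover have "(\<integral>x. H x \<partial>\<nu>) - (\<integral>x. C \<partial>\<nu>) = (\<integral>x. ?F x \<partial>\<nu>)"
    proof -
      have "H \<in> bounded_measurable M"
        using H s by (simp add: bounded_measurable_def cong: measurable_cong_sets)
      from bounded_measurable_integrable[OF \<nu> this] show ?thesis by simp
    qed
    ultimately show "((\<lambda>n. \<integral>x. f n x \<partial>\<nu>) \<longlongrightarrow> (\<integral>x. ?F x \<partial>\<nu>)) U" by simp
  qed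
  with Fb show ?thesis by (rule that)
qed

section \<open>Kernels preserving null sets\<close>

text \<open>
  Preservation of null sets is what makes \<open>markov_op K\<close> act on classes modulo null sets; then it is
  the adjoint of \<open>\<nu> \<mapsto> \<nu> K\<close> on absolutely continuous measures, and therefore weak-* continuous. The
  kernels are only required to be sub-Markovian, so that convolutions by systems of measures are
  covered as well.
\<close>

definition null_preserving_kernel :: "'a measure \<Rightarrow> ('a \<Rightarrow> 'a measure) \<Rightarrow> bool" where
  "null_preserving_kernel M K \<longleftrightarrow> K \<in> measurable M (subprob_algebra M) \<and>
     (\<forall>N\<in>null_sets M. AE x in M. emeasure (K x) N = 0)"

lemma markov_op_cong:
  assumes "\<And>y. y \<in> space (K x) \<Longrightarrow> f y = g y"
  shows "markov_op K f x = markov_op K g x"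
  unfolding markov_op_def by (rule Bochner_Integration.integral_cong) (use assms in auto)

lemma null_preserving_kernelD:
  assumes "null_preserving_kernel M K" "x \<in> space M"
  shows "subprob_space (K x)" "sets (K x) = sets M" "space (K x) = space M"
  using assms subprob_space_kernel[of K M M x] sets_kernel[of K M M x]
    sets_eq_imp_space_eq[of "K x" M]
  by (auto simp: null_preserving_kernel_def)

lemma bounded_measurable_integrable_kernel:
  assumes K: "null_preserving_kernel M K" "x \<in> space M" and f: "f \<in> bounded_measurable M"
  shows "integrable (K x) f"
proof -
  note k = null_preserving_kernelD[OF K]
  interpret subprob_space "K x" by (rule k)
  obtain C where "f \<in> borel_measurable M" "0 \<le> C" "\<And>x. x \<in> space M \<Longrightarrow> \<bar>f x\<bar> \<le> C"
    using bounded_measurableE[OF f] by blast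
  then show ?thesis
    using k by (intro integrable_const_bound[of _ C]) (auto cong: measurable_cong_sets)
qed

lemma markov_op_bound:
  assumes K: "null_preserving_kernel M K" "x \<in> space M"
    and f: "f \<in> borel_measurable M" "0 \<le> C" "\<And>x. x \<in> space M \<Longrightarrow> \<bar>f x\<bar> \<le> C"
  shows "\<bar>markov_op K f x\<bar> \<le> C"
proof -
  note k = null_preserving_kernelD[OF K]
  interpret subprob_space "K x" by (rule k)
  have int: "integrable (K x) f"
    using f by (intro bounded_measurable_integrable_kernel[OF K] bounded_measurableI)
  have "\<bar>markov_op K f x\<bar> \<le> (\<integral>y. \<bar>f y\<bar> \<partial>K x)"
    unfolding markov_op_def by (rule integral_abs_bound)
  also have "\<dots> \<le> (\<integral>y. C \<partial>K x)"
    using f(3) k int by (intro integral_mono) auto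
  also have "\<dots> = C * measure (K x) (space (K x))" by simp
  also have "\<dots> \<le> C * 1" by (intro mult_left_mono subprob_measure_le_1 f)
  finally show ?thesis by simp
qed

lemma markov_op_bounded_measurable:
  assumes K: "null_preserving_kernel M K" and f: "f \<in> bounded_measurable M"
  shows "markov_op K f \<in> bounded_measurable M"
proof -
  obtain C where C: "f \<in> borel_measurable M" "0 \<le> C" "\<And>x. x \<in> space M \<Longrightarrow> \<bar>f x\<bar> \<le> C"
    using bounded_measurableE[OF f] by blast
  have "K \<in> measurable M (subprob_algebra M)"
    using K by (simp add: null_preserving_kernel_def)
  from measurable_compose[OF this integral_measurable_subprob_algebra[OF C(1)]]
  have "markov_op K f \<in> borel_measurable M"
    by (simp add: markov_op_def[abs_def])
  then show ?thesis
    by (rule bounded_measurableI) (rule markov_op_bound[OF K _ C])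
qed

lemma markov_op_linear:
  assumes K: "null_preserving_kernel M K" "x \<in> space M"
    and f: "f \<in> bounded_measurable M" and g: "g \<in> bounded_measurable M"
  shows "markov_op K (\<lambda>y. a * f y + b * g y) x = a * markov_op K f x + b * markov_op K g x"
  unfolding markov_op_def
  using bounded_measurable_integrable_kernel[OF K f] bounded_measurable_integrable_kernel[OF K g]
  by simp

lemma AE_kernel:
  assumes K: "null_preserving_kernel M K" and P: "AE y in M. P y"
  shows "AE x in M. AE y in K x. P y"
proof -
  obtain N where N: "N \<in> null_sets M" "{y \<in> space M. \<not> P y} \<subseteq> N"
    using P unfolding eventually_ae_filter by auto
  have "AE x in M. emeasure (K x) N = 0"
    using K N by (auto simp: null_preserving_kernel_def)
  then show ?thesis
    using AE_space
  proof eventually_elim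
    case (elim x)
    note k = null_preserving_kernelD[OF K elim(2)]
    have "N \<in> null_sets (K x)" using elim N k by (auto simp: null_sets_def)
    with N k show ?case by (intro AE_I'[of N]) auto
  qed
qed

lemma markov_op_mono_AE:
  assumes K: "null_preserving_kernel M K"
    and f: "f \<in> bounded_measurable M" and g: "g \<in> bounded_measurable M"
    and le: "AE x in M. f x \<le> g x"
  shows "AE x in M. markov_op K f x \<le> markov_op K g x"
  using AE_kernel[OF K le] AE_space
proof eventually_elim
  case (elim x)
  then show ?case
    unfolding markov_op_def
    by (intro integral_mono_AE bounded_measurable_integrable_kernel[OF K] f g)
qed

text \<open>
  The action of the kernel on the predual, and the duality with \<open>markov_op K\<close>.
\<close>

lemma integral_kernel_finite_below:
  assumes K: "null_preserving_kernel M K" and \<nu>: "\<nu> \<in> finite_below M" and ne: "space M \<noteq> {}"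
  shows "\<nu> \<bind> K \<in> finite_below M"
    and "f \<in> bounded_measurable M \<Longrightarrow> (\<integral>x. f x \<partial>(\<nu> \<bind> K)) = (\<integral>x. markov_op K f x \<partial>\<nu>)"
proof -
  note s = finite_belowD(2,3)[OF \<nu>]
  interpret n: finite_measure \<nu> by (rule finite_belowD[OF \<nu>])
  have Kn: "K \<in> measurable \<nu> (subprob_algebra M)"
    using K s by (simp add: null_preserving_kernel_def cong: measurable_cong_sets)
  have sets: "sets (\<nu> \<bind> K) = sets M" and space: "space (\<nu> \<bind> K) = space M"
    using ne s by (simp_all add: sets_bind_measurable[OF Kn] space_bind_measurable[OF Kn])
  have em: "emeasure (\<nu> \<bind> K) A = (\<integral>\<^sup>+x. emeasure (K x) A \<partial>\<nu>)" if "A \<in> sets M" for A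
    using emeasure_bind[OF _ Kn that] ne s by simp
  have "emeasure (\<nu> \<bind> K) (space M) \<le> (\<integral>\<^sup>+x. 1 \<partial>\<nu>)"
    unfolding em[OF sets.top]
  proof (rule nn_integral_mono)
    fix x assume "x \<in> space \<nu>"
    then have "x \<in> space M" using s by simp
    from null_preserving_kernelD[OF K this] show "emeasure (K x) (space M) \<le> 1"
      using subprob_space.emeasure_space_le_1[of "K x"] by simp
  qed
  also have "\<dots> < \<infinity>" by (simp add: less_top[symmetric])
  finally have fin: "finite_measure (\<nu> \<bind> K)"
    by (intro finite_measureI) (simp add: space)
  have "absolutely_continuous M (\<nu> \<bind> K)"
    unfolding absolutely_continuous_def
  proof
    fix N assume N: "N \<in> null_sets M"
    then have "AE x in \<nu>. emeasure (K x) N = 0"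
      using K by (intro finite_belowD(4)[OF \<nu>]) (auto simp: null_preserving_kernel_def)
    then have "(\<integral>\<^sup>+x. emeasure (K x) N \<partial>\<nu>) = (\<integral>\<^sup>+x. 0 \<partial>\<nu>)"
      by (rule nn_integral_cong_AE)
    with N em[of N] sets show "N \<in> null_sets (\<nu> \<bind> K)" by auto
  qed
  with fin sets show mem: "\<nu> \<bind> K \<in> finite_below M"
    by (simp add: finite_below_def)
  interpret b: finite_measure "\<nu> \<bind> K" by (rule fin)
  show "(\<integral>x. f x \<partial>(\<nu> \<bind> K)) = (\<integral>x. markov_op K f x \<partial>\<nu>)" if f: "f \<in> bounded_measurable M"
  proof -
    obtain C where C: "f \<in> borel_measurable M" "0 \<le> C" "\<And>x. x \<in> space M \<Longrightarrow> \<bar>f x\<bar> \<le> C"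
      using bounded_measurableE[OF f] by blast
    let ?D = "distr \<nu> (subprob_algebra M) K"
    have "\<nu> \<bind> K = join ?D"
      using ne s by (intro bind_nonempty''[OF Kn]) simp
    then have "(\<integral>x. f x \<partial>(\<nu> \<bind> K)) = (\<integral>x. f x \<partial>join ?D)" by simp
    also have "\<dots> = (\<integral>\<kappa>. (\<integral>x. f x \<partial>\<kappa>) \<partial>?D)"
    proof (rule integral_join)
      show "finite_measure ?D" using Kn by (rule n.finite_measure_distr)
      show "AE \<kappa> in ?D. emeasure \<kappa> (space \<kappa>) \<le> ennreal 1"
        by (intro AE_I2) (simp add: space_subprob_algebra subprob_space.emeasure_space_le_1)
    qed (use C in auto)
    also have "\<dots> = (\<integral>x. markov_op K f x \<partial>\<nu>)"
      unfolding markov_op_def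
      by (rule integral_distr[OF Kn integral_measurable_subprob_algebra[OF C(1)]])
    finally show ?thesis .
  qed
qed

lemma weak_limit_markov_op:
  assumes K: "null_preserving_kernel M K"
    and f: "weak_limit U M f F" "F \<in> bounded_measurable M" "\<And>n. f n \<in> bounded_measurable M"
  shows "weak_limit U M (\<lambda>n. markov_op K (f n)) (markov_op K F)"
  unfolding weak_limit_def
proof
  fix \<nu> assume \<nu>: "\<nu> \<in> finite_below M"
  show "((\<lambda>n. \<integral>x. markov_op K (f n) x \<partial>\<nu>) \<longlongrightarrow> (\<integral>x. markov_op K F x \<partial>\<nu>)) U"
  proof (cases "space M = {}")
    \<comment> \<open>On an empty space the monadic bind carries a degenerate sigma-algebra.\<close>
    case True
    then have "(\<integral>x. h x \<partial>\<nu>) = 0" for h :: "'a \<Rightarrow> real"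
      using finite_belowD(3)[OF \<nu>]
      by (subst Bochner_Integration.integral_cong[OF refl, of \<nu> h "\<lambda>_. 0"]) auto
    then show ?thesis by simp
  next
    case False
    note i = integral_kernel_finite_below[OF K \<nu> False]
    show ?thesis
      using f(1) i(1) unfolding weak_limit_def i(2)[OF f(2), symmetric] i(2)[OF f(3), symmetric]
      by blast
  qed
qed

lemma weak_limit_linear:
  assumes f: "weak_limit U M f F" "F \<in> bounded_measurable M" "\<And>n. f n \<in> bounded_measurable M"
    and g: "weak_limit U M g G" "G \<in> bounded_measurable M" "\<And>n. g n \<in> bounded_measurable M"
  shows "weak_limit U M (\<lambda>n x. a * f n x + b * g n x) (\<lambda>x. a * F x + b * G x)"
  unfolding weak_limit_def
proof
  fix \<nu> assume \<nu>: "\<nu> \<in> finite_below M"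
  have "(\<integral>x. a * u x + b * v x \<partial>\<nu>) = a * (\<integral>x. u x \<partial>\<nu>) + b * (\<integral>x. v x \<partial>\<nu>)"
    if "u \<in> bounded_measurable M" "v \<in> bounded_measurable M" for u v
    using bounded_measurable_integrable[OF \<nu> that(1)] bounded_measurable_integrable[OF \<nu> that(2)]
    by simp
  moreover have "((\<lambda>n. a * (\<integral>x. f n x \<partial>\<nu>) + b * (\<integral>x. g n x \<partial>\<nu>)) \<longlongrightarrow>
      a * (\<integral>x. F x \<partial>\<nu>) + b * (\<integral>x. G x \<partial>\<nu>)) U"
    using f(1) g(1) \<nu> by (intro tendsto_intros) (auto simp: weak_limit_def)
  ultimately show "((\<lambda>n. \<integral>x. a * f n x + b * g n x \<partial>\<nu>) \<longlongrightarrow> (\<integral>x. a * F x + b * G x \<partial>\<nu>)) U"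
    using f g by simp
qed

text \<open>
  The factor \<open>c\<close> is absorbed into the test measure.
\<close>

lemma weak_limit_mult:
  assumes f: "weak_limit U M f F" "F \<in> bounded_measurable M" "\<And>n. f n \<in> bounded_measurable M"
    and c: "c \<in> bounded_measurable M" "\<And>x. x \<in> space M \<Longrightarrow> 0 \<le> c x"
  shows "weak_limit U M (\<lambda>n x. c x * f n x) (\<lambda>x. c x * F x)"
  unfolding weak_limit_def
proof
  fix \<nu> assume \<nu>: "\<nu> \<in> finite_below M"
  show "((\<lambda>n. \<integral>x. c x * f n x \<partial>\<nu>) \<longlongrightarrow> (\<integral>x. c x * F x \<partial>\<nu>)) U"
    using f(1) finite_below_density[OF \<nu> c]
      integral_finite_below_density[OF \<nu> c(1) f(2) c(2)]
      integral_finite_below_density[OF \<nu> c(1) f(3) c(2)]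
    by (auto simp: weak_limit_def)
qed

lemma weak_limit_cong:
  assumes "\<And>n x. x \<in> space M \<Longrightarrow> f n x = g n x" "weak_limit U M f F"
  shows "weak_limit U M g F"
proof -
  have "(\<integral>x. f n x \<partial>\<nu>) = (\<integral>x. g n x \<partial>\<nu>)" if "\<nu> \<in> finite_below M" for \<nu> n
    using assms(1) finite_belowD(3)[OF that] by (intro Bochner_Integration.integral_cong) auto
  with assms(2) show ?thesis by (simp add: weak_limit_def)
qed

lemma weak_limit_cong_AE:
  assumes "weak_limit U M f F" "AE x in M. F x = H x"
    "F \<in> bounded_measurable M" "H \<in> bounded_measurable M"
  shows "weak_limit U M f H"
proof -
  have "(\<integral>x. F x \<partial>\<nu>) = (\<integral>x. H x \<partial>\<nu>)" if "\<nu> \<in> finite_below M" for \<nu>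
    using bounded_measurable_integrable[OF that assms(3)] bounded_measurable_integrable[OF that assms(4)]
      finite_belowD(4)[OF that assms(2)]
    by (intro integral_cong_AE borel_measurable_integrable)
  with assms(1) show ?thesis by (simp add: weak_limit_def)
qed

section \<open>Averages of the powers of a Markov operator\<close>

locale ergodic_averaging = sigma_finite_measure M for M :: "'a measure" +
  fixes K :: "'a \<Rightarrow> 'a measure" and U :: "nat filter"
  assumes kernel: "null_preserving_kernel M K"
    and U: "generalized_limit U"
begin

abbreviation "P \<equiv> markov_op K"

definition average :: "('a \<Rightarrow> real) \<Rightarrow> nat \<Rightarrow> 'a \<Rightarrow> real" where
  "average f n x = (\<Sum>k<n. (P ^^ k) f x) / real n"

lemma markov_op_cong_space:
  assumes "x \<in> space M" "\<And>y. y \<in> space M \<Longrightarrow> f y = g y"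
  shows "P f x = P g x"
  using assms null_preserving_kernelD[OF kernel assms(1)] by (intro markov_op_cong) auto

lemma iterate_bound:
  assumes f: "f \<in> borel_measurable M" "0 \<le> C" "\<And>x. x \<in> space M \<Longrightarrow> \<bar>f x\<bar> \<le> C"
  shows "(P ^^ k) f \<in> bounded_measurable M" "x \<in> space M \<Longrightarrow> \<bar>(P ^^ k) f x\<bar> \<le> C"
proof (induction k arbitrary: x)
  case 0
  { case 1 show ?case using f by (auto intro: bounded_measurableI) }
  { case 2 then show ?case using f by simp }
next
  case (Suc k)
  { case 1 show ?case using Suc markov_op_bounded_measurable[OF kernel] by simp }
  { case 2 then show ?case
      using markov_op_bound[OF kernel 2 _ f(2) Suc(2)] Suc(1)
      by (simp add: bounded_measurable_measurable) }
qed

lemma iterate_bounded_measurable: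
  assumes "f \<in> bounded_measurable M" shows "(P ^^ k) f \<in> bounded_measurable M"
  using assms iterate_bound(1) by (metis bounded_measurableE)

lemma average_bound:
  assumes f: "f \<in> borel_measurable M" "0 \<le> C" "\<And>x. x \<in> space M \<Longrightarrow> \<bar>f x\<bar> \<le> C"
    and x: "x \<in> space M"
  shows "\<bar>average f n x\<bar> \<le> C"
proof (cases "n = 0")
  case False
  have "\<bar>\<Sum>k<n. (P ^^ k) f x\<bar> \<le> (\<Sum>k<n. C)"
    by (intro order_trans[OF sum_abs] sum_mono iterate_bound(2)[OF f x])
  with False show ?thesis by (simp add: average_def field_simps)
qed (use f in \<open>simp add: average_def\<close>)

lemma average_bounded_measurable:
  assumes "f \<in> bounded_measurable M" shows "average f n \<in> bounded_measurable M"
proof -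
  obtain C where C: "f \<in> borel_measurable M" "0 \<le> C" "\<And>x. x \<in> space M \<Longrightarrow> \<bar>f x\<bar> \<le> C"
    using bounded_measurableE[OF assms] by blast
  have "average f n \<in> borel_measurable M"
    unfolding average_def[abs_def]
    using bounded_measurable_measurable[OF iterate_bounded_measurable[OF assms]] by simp
  then show ?thesis
    by (rule bounded_measurableI) (rule average_bound[OF C])
qed

lemma iterate_linear:
  assumes f: "f \<in> bounded_measurable M" and g: "g \<in> bounded_measurable M" and x: "x \<in> space M"
  shows "(P ^^ k) (\<lambda>y. a * f y + b * g y) x = a * (P ^^ k) f x + b * (P ^^ k) g x"
  using x
proof (induction k arbitrary: x)
  case (Suc k)
  then have "(P ^^ Suc k) (\<lambda>y. a * f y + b * g y) x = P (\<lambda>y. a * (P ^^ k) f y + b * (P ^^ k) g y) x"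
    by (auto intro: markov_op_cong_space)
  also have "\<dots> = a * (P ^^ Suc k) f x + b * (P ^^ Suc k) g x"
    using markov_op_linear[OF kernel Suc.prems iterate_bounded_measurable[OF f]
        iterate_bounded_measurable[OF g]] by simp
  finally show ?case .
qed simp

lemma average_linear:
  assumes "f \<in> bounded_measurable M" "g \<in> bounded_measurable M" "x \<in> space M"
  shows "average (\<lambda>y. a * f y + b * g y) n x = a * average f n x + b * average g n x"
  unfolding average_def iterate_linear[OF assms]
  by (simp add: sum.distrib sum_distrib_left add_divide_distrib)

lemma average_mono_AE:
  assumes f: "f \<in> bounded_measurable M" and g: "g \<in> bounded_measurable M"
    and le: "AE x in M. f x \<le> g x"
  shows "AE x in M. average f n x \<le> average g n x"
proof -
  have "AE x in M. (P ^^ k) f x \<le> (P ^^ k) g x" for k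
  proof (induction k)
    case (Suc k)
    from markov_op_mono_AE[OF kernel iterate_bounded_measurable[OF f] iterate_bounded_measurable[OF g] this]
    show ?case by simp
  qed (use le in simp)
  then have "AE x in M. \<forall>k. (P ^^ k) f x \<le> (P ^^ k) g x"
    by (simp add: AE_all_countable)
  then show ?thesis
    by eventually_elim (auto simp: average_def intro!: divide_right_mono sum_mono)
qed

lemma average_one:
  assumes K1: "\<And>x. x \<in> space M \<Longrightarrow> prob_space (K x)" and x: "x \<in> space M" and n: "0 < n"
  shows "average (\<lambda>_. 1) n x = 1"
proof -
  have "(P ^^ k) (\<lambda>_. 1) x = 1" if "x \<in> space M" for k x
    using that
  proof (induction k arbitrary: x)
    case (Suc k)
    then have "(P ^^ Suc k) (\<lambda>_. 1) x = P (\<lambda>_. 1) x"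
      by (auto intro: markov_op_cong_space)
    also have "\<dots> = 1"
      using prob_space.prob_space[OF K1[OF Suc.prems]] by (simp add: markov_op_def)
    finally show ?case .
  qed simp
  with x n show ?thesis by (simp add: average_def)
qed

lemma markov_op_average:
  assumes f: "f \<in> bounded_measurable M" and x: "x \<in> space M"
  shows "P (average f n) x = average f n x + ((P ^^ n) f x - f x) / real n"
proof -
  have "P (average f n) x = (\<Sum>k<n. P ((P ^^ k) f) x) / real n"
    unfolding markov_op_def average_def[abs_def]
    using bounded_measurable_integrable_kernel[OF kernel x iterate_bounded_measurable[OF f]]
    by (simp add: markov_op_def[abs_def])
  also have "(\<Sum>k<n. P ((P ^^ k) f) x) = (\<Sum>k<n. (P ^^ k) f x) + ((P ^^ n) f x - f x)"
    by (induction n) auto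
  finally show ?thesis unfolding add_divide_distrib average_def[of f n x, symmetric] .
qed

lemma averages_have_weak_limit:
  assumes f: "f \<in> bounded_measurable M"
  obtains F where "F \<in> bounded_measurable M" "weak_limit U M (average f) F"
proof -
  obtain C where C: "f \<in> borel_measurable M" "0 \<le> C" "\<And>x. x \<in> space M \<Longrightarrow> \<bar>f x\<bar> \<le> C"
    using bounded_measurableE[OF f] by blast
  show ?thesis
    using bounded_sequence_has_weak_limit[OF U, of "average f" C] that
      bounded_measurable_measurable[OF average_bounded_measurable[OF f]] average_bound[OF C]
    by blast
qed

text \<open>
  \<open>P (A\<^sub>n f) - A\<^sub>n f = (P\<^sup>n f - f) / n\<close> tends to zero uniformly, and \<open>P\<close> is weak-* continuous.
\<close>

lemma weak_limit_of_averages_invariant: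
  assumes f: "f \<in> bounded_measurable M"
    and F: "F \<in> bounded_measurable M" "weak_limit U M (average f) F"
  shows "AE x in M. P F x = F x"
proof -
  note A = average_bounded_measurable[OF f]
  have PA: "P (average f n) \<in> bounded_measurable M" for n
    by (intro markov_op_bounded_measurable[OF kernel] A)
  have PF: "P F \<in> bounded_measurable M"
    by (intro markov_op_bounded_measurable[OF kernel] F)
  have lim1: "weak_limit U M (\<lambda>n. P (average f n)) (P F)"
    by (rule weak_limit_markov_op[OF kernel F(2,1) A])
  obtain C where C: "f \<in> borel_measurable M" "0 \<le> C" "\<And>x. x \<in> space M \<Longrightarrow> \<bar>f x\<bar> \<le> C"
    using bounded_measurableE[OF f] by blast
  define r where "r = (\<lambda>n x. ((P ^^ n) f x - f x) / real n)"
  have rb: "\<bar>r n x\<bar> \<le> 2 * C / real n" if "x \<in> space M" for n x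
  proof -
    have "\<bar>(P ^^ n) f x - f x\<bar> \<le> 2 * C"
      using iterate_bound(2)[OF C that, of n] C(3)[OF that] by linarith
    then show ?thesis by (simp add: r_def abs_divide divide_right_mono)
  qed
  have rm: "r n \<in> bounded_measurable M" for n
  proof (rule bounded_measurableI[OF _ rb])
    show "r n \<in> borel_measurable M"
      using bounded_measurable_measurable[OF iterate_bounded_measurable[OF f, of n]] C(1)
      by (simp add: r_def)
  qed
  have rlim: "weak_limit U M r (\<lambda>_. 0)"
    unfolding weak_limit_def
  proof
    fix \<nu> assume \<nu>: "\<nu> \<in> finite_below M"
    interpret n: finite_measure \<nu> by (rule finite_belowD[OF \<nu>])
    let ?c = "2 * C * measure \<nu> (space \<nu>)"
    have "\<bar>\<integral>x. r n x \<partial>\<nu>\<bar> \<le> ?c * inverse (real n)" for n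
    proof -
      have "\<bar>\<integral>x. r n x \<partial>\<nu>\<bar> \<le> (\<integral>x. \<bar>r n x\<bar> \<partial>\<nu>)" by (rule integral_abs_bound)
      also have "\<dots> \<le> (\<integral>x. 2 * C / real n \<partial>\<nu>)"
        using bounded_measurable_integrable[OF \<nu> rm[of n]] rb finite_belowD(3)[OF \<nu>]
        by (intro integral_mono) auto
      finally show ?thesis by (simp add: field_simps)
    qed
    then have le: "\<forall>\<^sub>F n in sequentially. norm (\<integral>x. r n x \<partial>\<nu>) \<le> ?c * inverse (real n)"
      by (intro always_eventually) simp
    have "(\<lambda>n. ?c * inverse (real n)) \<longlonglongrightarrow> 0"
      by (intro tendsto_mult_right_zero lim_inverse_n)
    from Lim_null_comparison[OF le this] have "(\<lambda>n. \<integral>x. r n x \<partial>\<nu>) \<longlonglongrightarrow> 0" .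
    moreover have "U \<le> sequentially" using U by (simp add: generalized_limit_def)
    ultimately show "((\<lambda>n. \<integral>x. r n x \<partial>\<nu>) \<longlongrightarrow> (\<integral>x. 0 \<partial>\<nu>)) U"
      by (simp add: tendsto_mono)
  qed
  have "weak_limit U M (\<lambda>n x. 1 * average f n x + 1 * r n x) (\<lambda>x. 1 * F x + 1 * 0)"
    by (intro weak_limit_linear F rlim A rm bounded_measurable_const)
  then have "weak_limit U M (\<lambda>n x. average f n x + r n x) F" by simp
  with _ have lim2: "weak_limit U M (\<lambda>n. P (average f n)) F"
    by (rule weak_limit_cong) (simp only: markov_op_average[OF f] r_def)
  have "AE x in M. P F x \<le> F x"
    by (rule weak_limit_mono[OF U lim1 PF PA lim2 F(1) PA]) simp
  moreover have "AE x in M. F x \<le> P F x"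
    by (rule weak_limit_mono[OF U lim2 F(1) PA lim1 PF PA]) simp
  ultimately show ?thesis by eventually_elim simp
qed

text \<open>
  Together with weak-* continuity of \<open>markov_op L\<close> this shows that taking the limit of averages
  commutes with \<open>markov_op L\<close>; it is the source of the equivariance of the mean.
\<close>

lemma average_commute:
  assumes L: "null_preserving_kernel M L"
    and comm: "\<And>f x. f \<in> bounded_measurable M \<Longrightarrow> x \<in> space M \<Longrightarrow>
      P (markov_op L f) x = markov_op L (P f) x"
    and f: "f \<in> bounded_measurable M" and x: "x \<in> space M"
  shows "average (markov_op L f) n x = markov_op L (average f n) x"
proof -
  have it: "(P ^^ k) (markov_op L f) x = markov_op L ((P ^^ k) f) x" if "x \<in> space M" for k x
    using that
  proof (induction k arbitrary: x)
    case (Suc k)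
    then have "(P ^^ Suc k) (markov_op L f) x = P (markov_op L ((P ^^ k) f)) x"
      by (auto intro: markov_op_cong_space)
    also have "\<dots> = markov_op L ((P ^^ Suc k) f) x"
      using comm[OF iterate_bounded_measurable[OF f] Suc.prems] by simp
    finally show ?case .
  qed simp
  have "markov_op L (average f n) x = (\<Sum>k<n. markov_op L ((P ^^ k) f) x) / real n"
    unfolding markov_op_def average_def[abs_def]
    using bounded_measurable_integrable_kernel[OF L x iterate_bounded_measurable[OF f]]
    by (simp add: markov_op_def[abs_def])
  with it[OF x] show ?thesis by (simp add: average_def)
qed

lemma average_mult_invariant:
  assumes comm: "\<And>f x. f \<in> bounded_measurable M \<Longrightarrow> x \<in> space M \<Longrightarrow>
      P (\<lambda>y. c y * f y) x = c x * P f x"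
    and f: "f \<in> bounded_measurable M" and x: "x \<in> space M"
  shows "average (\<lambda>y. c y * f y) n x = c x * average f n x"
proof -
  have it: "(P ^^ k) (\<lambda>y. c y * f y) x = c x * (P ^^ k) f x" if "x \<in> space M" for k x
    using that
  proof (induction k arbitrary: x)
    case (Suc k)
    then have "(P ^^ Suc k) (\<lambda>y. c y * f y) x = P (\<lambda>y. c y * (P ^^ k) f y) x"
      by (auto intro: markov_op_cong_space)
    also have "\<dots> = c x * (P ^^ Suc k) f x"
      using comm[OF iterate_bounded_measurable[OF f] Suc.prems] by simp
    finally show ?case .
  qed simp
  from it[OF x] show ?thesis by (simp add: average_def sum_distrib_left)
qed

end

section \<open>Disintegration of measures\<close>

lemma borel_system_sets:
  assumes "borel_system X Y F \<kappa>" "x \<in> space X"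
  shows "sets (\<kappa> x) = sets (restrict_space Y (F x))" "space (\<kappa> x) = F x \<inter> space Y"
proof -
  show s: "sets (\<kappa> x) = sets (restrict_space Y (F x))"
    using assms by (auto simp: borel_system_def)
  then show "space (\<kappa> x) = F x \<inter> space Y"
    using sets_eq_imp_space_eq[OF s] by (auto simp: space_restrict_space)
qed

lemma borel_system_measurable:
  assumes "borel_system X Y F \<kappa>" "x \<in> space X" "f \<in> measurable Y Z"
  shows "f \<in> measurable (\<kappa> x) Z"
  using measurable_restrict_space1[OF assms(3), of "F x"] borel_system_sets(1)[OF assms(1,2)]
  by (simp cong: measurable_cong_sets)

lemma borel_system_emeasure_measurable:
  assumes \<kappa>: "borel_system X Y F \<kappa>" and A: "A \<in> sets Y"
  shows "(\<lambda>x. emeasure (\<kappa> x) (A \<inter> space (\<kappa> x))) \<in> borel_measurable X"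
proof -
  have "(\<lambda>x. \<integral>\<^sup>+ y. indicator A y \<partial>\<kappa> x) \<in> borel_measurable X"
    using \<kappa> A by (auto simp: borel_system_def)
  then show ?thesis
    by (subst measurable_cong) (auto simp: borel_system_emeasure(2)[OF \<kappa> _ A])
qed

lemma borel_system_AE_measurable:
  assumes \<kappa>: "borel_system X Y F \<kappa>" and Q: "{y \<in> space Y. Q y} \<in> sets Y"
  shows "{x \<in> space X. AE y in \<kappa> x. Q y} \<in> sets X"
    and "x \<in> space X \<Longrightarrow> (AE y in \<kappa> x. Q y) \<longleftrightarrow>
      emeasure (\<kappa> x) ({y \<in> space Y. \<not> Q y} \<inter> space (\<kappa> x)) = 0"
proof -
  let ?N = "{y \<in> space Y. \<not> Q y}"
  have N: "?N \<in> sets Y"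
    using sets.compl_sets[OF Q] by (rule back_subst[where P = "\<lambda>A. A \<in> sets Y"]) auto
  have iff: "(AE y in \<kappa> x. Q y) \<longleftrightarrow> emeasure (\<kappa> x) (?N \<inter> space (\<kappa> x)) = 0" if x: "x \<in> space X" for x
    using borel_system_sets[OF \<kappa> x]
    by (intro AE_iff_measurable[OF borel_system_emeasure(1)[OF \<kappa> x N]]) auto
  then show "x \<in> space X \<Longrightarrow> (AE y in \<kappa> x. Q y) \<longleftrightarrow> emeasure (\<kappa> x) (?N \<inter> space (\<kappa> x)) = 0" .
  have "{x \<in> space X. emeasure (\<kappa> x) (?N \<inter> space (\<kappa> x)) = 0} \<in> sets X"
    using borel_system_emeasure_measurable[OF \<kappa> N] by measurable
  then show "{x \<in> space X. AE y in \<kappa> x. Q y} \<in> sets X"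
    using iff by (simp cong: conj_cong)
qed

lemma AE_integrate_system:
  assumes \<kappa>: "borel_system X Y F \<kappa>" and \<mu>: "sets \<mu> = sets X" and Q: "{y \<in> space Y. Q y} \<in> sets Y"
  shows "(AE y in integrate_system Y \<kappa> \<mu>. Q y) \<longleftrightarrow> (AE x in \<mu>. AE y in \<kappa> x. Q y)"
proof -
  let ?N = "{y \<in> space Y. \<not> Q y}"
  have N: "?N \<in> sets Y"
    using sets.compl_sets[OF Q] by (rule back_subst[where P = "\<lambda>A. A \<in> sets Y"]) auto
  have "(AE y in integrate_system Y \<kappa> \<mu>. Q y) \<longleftrightarrow> emeasure (integrate_system Y \<kappa> \<mu>) ?N = 0"
    using N by (intro AE_iff_measurable) auto
  also have "\<dots> \<longleftrightarrow> (AE x in \<mu>. emeasure (\<kappa> x) (?N \<inter> space (\<kappa> x)) = 0)"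
    unfolding emeasure_integrate_system[OF \<kappa> \<mu> N]
    using borel_system_emeasure_measurable[OF \<kappa> N] \<mu>
    by (intro nn_integral_0_iff_AE) (simp cong: measurable_cong_sets)
  also have "\<dots> \<longleftrightarrow> (AE x in \<mu>. AE y in \<kappa> x. Q y)"
    using borel_system_AE_measurable(2)[OF \<kappa> Q] sets_eq_imp_space_eq[OF \<mu>]
    by (intro AE_cong) auto
  finally show ?thesis .
qed

text \<open>
  The members of a countable cover of \<open>Y\<close> by sets of finite total measure have, simultaneously, finite
  measure on almost every fiber.
  Sigma-finiteness of the fiber measures is what allows Fubini arguments on the fibers.
\<close>

lemma AE_sigma_finite_system:
  assumes \<kappa>: "borel_system X Y F \<kappa>" and \<mu>: "sets \<mu> = sets X"
    and sf: "sigma_finite_measure (integrate_system Y \<kappa> \<mu>)"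
  shows "AE x in \<mu>. sigma_finite_measure (\<kappa> x)"
proof -
  let ?m = "integrate_system Y \<kappa> \<mu>"
  obtain A :: "nat \<Rightarrow> _" where A: "range A \<subseteq> sets ?m" "(\<Union>i. A i) = space ?m"
    "\<And>i. emeasure ?m (A i) \<noteq> \<infinity>"
    using sigma_finite_measure.sigma_finite[OF sf] by metis
  have AY: "A i \<in> sets Y" for i using A(1) by auto
  have "AE x in \<mu>. emeasure (\<kappa> x) (A i \<inter> space (\<kappa> x)) \<noteq> \<infinity>" for i
    using borel_system_emeasure_measurable[OF \<kappa> AY] \<mu> A(3)[of i] emeasure_integrate_system[OF \<kappa> \<mu> AY]
    by (intro nn_integral_PInf_AE) (simp_all cong: measurable_cong_sets)
  then have "AE x in \<mu>. \<forall>i. emeasure (\<kappa> x) (A i \<inter> space (\<kappa> x)) \<noteq> \<infinity>"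
    by (simp add: AE_all_countable)
  then show ?thesis
    using AE_space
  proof eventually_elim
    case (elim x)
    then have x: "x \<in> space X" using sets_eq_imp_space_eq[OF \<mu>] by simp
    let ?B = "(\<lambda>i. A i \<inter> space (\<kappa> x)) ` UNIV"
    have "\<Union>?B = space (\<kappa> x)"
      using A(2) borel_system_sets[OF \<kappa> x] by auto
    then show ?case
      using borel_system_emeasure(1)[OF \<kappa> x AY] elim
      by (intro sigma_finite_measure.intro exI[of _ ?B]) auto
  qed
qed

section \<open>Translations and null sets in measured groupoids\<close>

locale measured_groupoid_space =
  fixes G :: "('x, 'g) groupoid_data" and lam :: "'x \<Rightarrow> 'g measure" and \<mu> :: "'x measure"
  assumes measured_groupoid: "measured_groupoid G lam \<mu>"
begin

abbreviation "m \<equiv> haar_measure G lam \<mu>"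

lemma borel_groupoid: "borel_groupoid G" and haar: "borel_haar_system G lam"
  and sets_\<mu>: "sets \<mu> = sets (obj G)" and quasi_invariant: "quasi_invariant G lam \<mu>"
  using measured_groupoid by (simp_all add: measured_groupoid_def)

lemma space_\<mu>: "space \<mu> = space (obj G)"
  by (rule sets_eq_imp_space_eq[OF sets_\<mu>])

lemma groupoid: "groupoid G"
  and src_measurable: "src G \<in> measurable (arr G) (obj G)"
  and tgt_measurable: "tgt G \<in> measurable (arr G) (obj G)"
  and idt_measurable: "idt G \<in> measurable (obj G) (arr G)"
  and ginv_measurable: "ginv G \<in> measurable (arr G) (arr G)"
  and gmul_measurable: "(\<lambda>(g, h). gmul G g h) \<in>
       measurable (restrict_space (arr G \<Otimes>\<^sub>M arr G) (composable G)) (arr G)"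
  using borel_groupoid by (auto simp: borel_groupoid_def)

lemma lam: "borel_system (obj G) (arr G) (fib G) lam"
  using haar by (simp add: borel_haar_system_def)

lemma fib_space: "fib G x \<inter> space (arr G) = fib G x"
  by (auto simp: fib_def)

lemma ginv_simps:
  assumes "h \<in> space (arr G)"
  shows "ginv G h \<in> space (arr G)" "src G (ginv G h) = tgt G h" "tgt G (ginv G h) = src G h"
    "src G h \<in> space (obj G)" "tgt G h \<in> space (obj G)"
  using groupoid assms by (auto simp: groupoid_def)

lemma idt_simps:
  assumes "x \<in> space (obj G)"
  shows "idt G x \<in> space (arr G)" "src G (idt G x) = x" "tgt G (idt G x) = x"
  using groupoid assms by (auto simp: groupoid_def)

lemma division:
  assumes "h \<in> space (arr G)" "g \<in> space (arr G)" "tgt G h = tgt G g"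
  shows "(ginv G h, g) \<in> composable G" "gmul G (ginv G h) g \<in> space (arr G)"
    "tgt G (gmul G (ginv G h) g) = src G h"
proof -
  show c: "(ginv G h, g) \<in> composable G"
    using assms ginv_simps by (auto simp: composable_def)
  then show "gmul G (ginv G h) g \<in> space (arr G)" "tgt G (gmul G (ginv G h) g) = src G h"
    using groupoid ginv_simps[OF assms(1)] by (force simp: groupoid_def)+
qed

lemma division_cancel:
  assumes "h \<in> space (arr G)" "k \<in> fib G (src G h)"
  shows "gmul G (ginv G h) (gmul G h k) = k"
proof -
  have c: "(ginv G h, h) \<in> composable G" "(h, k) \<in> composable G"
    using assms ginv_simps by (auto simp: composable_def fib_def)
  then have "gmul G (ginv G h) (gmul G h k) = gmul G (gmul G (ginv G h) h) k"
    using groupoid unfolding groupoid_def by metis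
  also have "\<dots> = gmul G (idt G (src G h)) k"
    using groupoid assms by (auto simp: groupoid_def)
  also have "\<dots> = k"
    using groupoid assms by (auto simp: groupoid_def fib_def)
  finally show ?thesis .
qed

text \<open>
  The set of pairs of morphisms with a common target is not assumed measurable, hence the trace
  sigma-algebra.
\<close>

lemma division_measurable:
  "(\<lambda>(g, h). gmul G (ginv G h) g) \<in>
     measurable (restrict_space (arr G \<Otimes>\<^sub>M arr G) {(g, h). tgt G h = tgt G g}) (arr G)"
proof -
  have "(\<lambda>(g, h). (ginv G h, g)) \<in> measurable (restrict_space (arr G \<Otimes>\<^sub>M arr G) {(g, h). tgt G h = tgt G g})
      (restrict_space (arr G \<Otimes>\<^sub>M arr G) (composable G))"
  proof (rule measurable_restrict_space2)
    show "(\<lambda>(g, h). (ginv G h, g)) \<in>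
        space (restrict_space (arr G \<Otimes>\<^sub>M arr G) {(g, h). tgt G h = tgt G g}) \<rightarrow> composable G"
      using division(1) by (auto simp: space_restrict_space space_pair_measure)
    show "(\<lambda>(g, h). (ginv G h, g)) \<in>
        measurable (restrict_space (arr G \<Otimes>\<^sub>M arr G) {(g, h). tgt G h = tgt G g}) (arr G \<Otimes>\<^sub>M arr G)"
      using ginv_measurable by (intro measurable_restrict_space1) simp
  qed
  from measurable_comp[OF this gmul_measurable] show ?thesis
    by (simp add: o_def case_prod_beta')
qed

lemma division_measurable_fibers:
  assumes M: "sets M = sets (restrict_space (arr G) (fib G x))"
    and N: "sets N = sets (restrict_space (arr G) (fib G x))"
  shows "(\<lambda>(g, h). gmul G (ginv G h) g) \<in> measurable (M \<Otimes>\<^sub>M N) (arr G)"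
proof -
  let ?R = "restrict_space (arr G) (fib G x)"
  have "(\<lambda>p. p) \<in> measurable (?R \<Otimes>\<^sub>M ?R)
      (restrict_space (arr G \<Otimes>\<^sub>M arr G) {(g, h). tgt G h = tgt G g})"
  proof (rule measurable_restrict_space2)
    show "(\<lambda>p. p) \<in> space (?R \<Otimes>\<^sub>M ?R) \<rightarrow> {(g, h). tgt G h = tgt G g}"
      by (auto simp: space_pair_measure space_restrict_space fib_def)
    have "(\<lambda>p. (fst p, snd p)) \<in> measurable (?R \<Otimes>\<^sub>M ?R) (arr G \<Otimes>\<^sub>M arr G)"
      by (intro measurable_Pair measurable_compose[OF measurable_fst] measurable_compose[OF measurable_snd]
          measurable_restrict_space1) simp_all
    then show "(\<lambda>p. p) \<in> measurable (?R \<Otimes>\<^sub>M ?R) (arr G \<Otimes>\<^sub>M arr G)" by simp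
  qed
  from measurable_compose[OF this division_measurable] show ?thesis
    using M N by (simp cong: measurable_cong_sets sets_pair_measure_cong)
qed

lemma division_measurable_left:
  assumes g: "g \<in> fib G x" and N: "sets N = sets (restrict_space (arr G) (fib G x))"
  shows "(\<lambda>h. gmul G (ginv G h) g) \<in> measurable N (arr G)"
proof -
  have "g \<in> space N"
    using g sets_eq_imp_space_eq[OF N] fib_space by (simp add: space_restrict_space)
  from measurable_compose[OF measurable_Pair1'[OF this] division_measurable_fibers[OF N N]]
  show ?thesis by simp
qed

lemma division_measurable_right:
  assumes h: "h \<in> fib G x" and N: "sets N = sets (restrict_space (arr G) (fib G x))"
  shows "gmul G (ginv G h) \<in> measurable N (arr G)"
proof -
  have "h \<in> space N"
    using h sets_eq_imp_space_eq[OF N] fib_space by (simp add: space_restrict_space)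
  from measurable_compose[OF measurable_Pair2'[OF this] division_measurable_fibers[OF N N]]
  show ?thesis by simp
qed

lemma proper:
  obtains p where "p \<in> borel_measurable (arr G)"
    "\<And>x. x \<in> space (obj G) \<Longrightarrow> (\<integral>\<^sup>+ g. p g \<partial>lam x) = (1 :: ennreal)"
  using haar by (auto simp: borel_haar_system_def)

text \<open>
  Properness of the Haar system prevents the fiber measures from vanishing, so a property holding
  almost everywhere on a fiber holds somewhere on it.
\<close>

lemma haar_fiber_nontrivial:
  assumes x: "x \<in> space (obj G)" and Q: "AE g in lam x. Q g"
  obtains g where "g \<in> fib G x" "Q g"
proof -
  have "\<not> (AE g in lam x. False)"
  proof
    assume F: "AE g in lam x. False"
    obtain p where "(\<integral>\<^sup>+ g. p g \<partial>lam x) = (1 :: ennreal)" using proper x by metis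
    moreover have "(\<integral>\<^sup>+ g. p g \<partial>lam x) = (\<integral>\<^sup>+ g. 0 \<partial>lam x)"
      using F by (intro nn_integral_cong_AE) (auto elim: eventually_mono)
    ultimately show False by simp
  qed
  then have "\<exists>g\<in>space (lam x). Q g"
  proof (rule contrapos_np)
    assume "\<not> (\<exists>g\<in>space (lam x). Q g)"
    with Q AE_space[of "lam x"] show "AE g in lam x. False"
      by (auto elim: eventually_elim2)
  qed
  then show ?thesis
    using that borel_system_sets(2)[OF lam x] by (auto simp: fib_space)
qed

lemma AE_haar_tgt_iff:
  assumes Q: "{x \<in> space (obj G). Q x} \<in> sets (obj G)"
  shows "(AE g in m. Q (tgt G g)) \<longleftrightarrow> (AE x in \<mu>. Q x)"
proof -
  have "{g \<in> space (arr G). Q (tgt G g)} = tgt G -` {x \<in> space (obj G). Q x} \<inter> space (arr G)"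
    using ginv_simps by auto
  then have "{g \<in> space (arr G). Q (tgt G g)} \<in> sets (arr G)"
    using measurable_sets[OF tgt_measurable Q] by simp
  from AE_integrate_system[OF lam sets_\<mu> this]
  have "(AE g in m. Q (tgt G g)) \<longleftrightarrow> (AE x in \<mu>. AE g in lam x. Q (tgt G g))" .
  also have "\<dots> \<longleftrightarrow> (AE x in \<mu>. Q x)"
  proof (rule AE_cong)
    fix x assume "x \<in> space \<mu>"
    then have x: "x \<in> space (obj G)" by (simp add: space_\<mu>)
    show "(AE g in lam x. Q (tgt G g)) \<longleftrightarrow> Q x"
    proof
      assume "AE g in lam x. Q (tgt G g)"
      then show "Q x"
        using haar_fiber_nontrivial[OF x, of "\<lambda>g. Q (tgt G g)"] by (auto simp: fib_def)
    next
      assume "Q x"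
      then show "AE g in lam x. Q (tgt G g)"
        using borel_system_sets(2)[OF lam x] by (intro AE_I2) (auto simp: fib_def)
    qed
  qed
  finally show ?thesis .
qed

text \<open>
  Inversion exchanges \<open>src\<close> and \<open>tgt\<close> and preserves null sets: this is where quasi-invariance enters.
\<close>

lemma AE_haar_src:
  assumes Q: "{x \<in> space (obj G). Q x} \<in> sets (obj G)" and ae: "AE x in \<mu>. Q x"
  shows "AE g in m. Q (src G g)"
proof -
  have inv: "ginv G \<in> measurable m (arr G)"
    using ginv_measurable by (simp cong: measurable_cong_sets)
  have "{g \<in> space (arr G). Q (tgt G g)} = tgt G -` {x \<in> space (obj G). Q x} \<inter> space (arr G)"
    using ginv_simps by auto
  then have Qt: "{g \<in> space (arr G). Q (tgt G g)} \<in> sets (arr G)"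
    using measurable_sets[OF tgt_measurable Q] by simp
  have t: "AE g in m. Q (tgt G g)"
    using ae AE_haar_tgt_iff[OF Q] by simp
  have "absolutely_continuous m (distr m (arr G) (ginv G))"
    using quasi_invariant by (simp add: quasi_invariant_def Let_def)
  from absolutely_continuous_AE[OF _ this t] have "AE g in distr m (arr G) (ginv G). Q (tgt G g)"
    by simp
  then have "AE g in m. Q (tgt G (ginv G g))"
    using AE_distr_iff[OF inv Qt] by simp
  then show ?thesis
    using AE_space by eventually_elim (simp add: ginv_simps)
qed

text \<open>
  Left invariance of the Haar system: \<open>k \<mapsto> hk\<close> carries \<open>lam (src h)\<close> to \<open>lam x\<close>.
\<close>

lemma AE_haar_translate:
  assumes h: "h \<in> fib G x" and N: "{g \<in> space (arr G). Q g} \<in> sets (arr G)"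
    and ae: "AE k in lam (src G h). Q k"
  shows "AE g in lam x. Q (gmul G (ginv G h) g)"
proof -
  have ha: "h \<in> space (arr G)" and x: "x = tgt G h" using h by (auto simp: fib_def)
  have y: "src G h \<in> space (obj G)" and x': "x \<in> space (obj G)"
    using ginv_simps[OF ha] x by auto
  let ?R = "restrict_space (arr G) (fib G (tgt G h))"
  have eq: "lam x = distr (lam (src G h)) ?R (gmul G h)"
    using haar ha x by (auto simp: borel_haar_system_def translate_def)
  have m1: "gmul G h \<in> measurable (lam (src G h)) ?R"
    using gmul_measurable_fib[OF borel_groupoid ha] borel_system_sets(1)[OF lam y]
    by (simp cong: measurable_cong_sets)
  have m2: "gmul G (ginv G h) \<in> measurable ?R (arr G)"
    using h x by (intro division_measurable_right) auto
  have "{g \<in> space ?R. Q (gmul G (ginv G h) g)} =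
      gmul G (ginv G h) -` {g \<in> space (arr G). Q g} \<inter> space ?R"
    using measurable_space[OF m2] by auto
  then have "{g \<in> space ?R. Q (gmul G (ginv G h) g)} \<in> sets ?R"
    using measurable_sets[OF m2 N] by simp
  from AE_distr_iff[OF m1 this]
  have "(AE g in lam x. Q (gmul G (ginv G h) g)) \<longleftrightarrow>
      (AE k in lam (src G h). Q (gmul G (ginv G h) (gmul G h k)))"
    by (simp only: eq)
  also have "\<dots> \<longleftrightarrow> (AE k in lam (src G h). Q k)"
    using division_cancel[OF ha] borel_system_sets(2)[OF lam y]
    by (intro AE_cong) (auto simp: fib_space)
  finally show ?thesis using ae by simp
qed

end

section \<open>Convolution as a kernel\<close>

text \<open>
  The measures of a system live on the trace sigma-algebras of varying sets. Regarded as measures on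
  the whole space they form, if their masses are at most one, a kernel in the sense of the Giry monad.
\<close>

definition push :: "'y measure \<Rightarrow> ('x \<Rightarrow> 'y measure) \<Rightarrow> 'x \<Rightarrow> 'y measure" where
  "push Y \<kappa> x = distr (\<kappa> x) Y (\<lambda>y. y)"

lemma sets_push [simp]: "sets (push Y \<kappa> x) = sets Y" and space_push [simp]: "space (push Y \<kappa> x) = space Y"
  by (simp_all add: push_def)

lemma emeasure_push:
  assumes \<kappa>: "borel_system X Y F \<kappa>" and x: "x \<in> space X" and A: "A \<in> sets Y"
  shows "emeasure (push Y \<kappa> x) A = emeasure (\<kappa> x) (A \<inter> space (\<kappa> x))"
  unfolding push_def using A by (subst emeasure_distr) (auto intro: borel_system_measurable[OF \<kappa> x])

lemma markov_op_push:
  assumes \<kappa>: "borel_system X Y F \<kappa>" and x: "x \<in> space X" and f: "f \<in> borel_measurable Y"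
  shows "markov_op (push Y \<kappa>) f x = (\<integral>y. f y \<partial>\<kappa> x)"
  unfolding push_def markov_op_def using f
  by (subst integral_distr) (auto intro: borel_system_measurable[OF \<kappa> x])

context measured_groupoid_space
begin

lemma bounded_measurable_m: "bounded_measurable m = bounded_measurable (arr G)"
  by (simp add: bounded_measurable_def cong: measurable_cong_sets)

text \<open>
  Normalization of a system of finite measures whose masses need not be bounded. Because the weight
  is a strictly positive function of the target, it can be cancelled at the end.
\<close>

definition weight :: "('x \<Rightarrow> 'g measure) \<Rightarrow> 'x \<Rightarrow> real" where
  "weight \<theta> x = 1 / (1 + measure (\<theta> x) (space (\<theta> x)))"

lemma weight_pos: "0 < weight \<theta> x" "weight \<theta> x \<le> 1"
  by (simp_all add: weight_def add_pos_nonneg)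

text \<open>
  The kernel whose operator is \<open>f \<mapsto> \<theta> * f\<close>, multiplied by the weight of the target.
\<close>

definition conv_kernel :: "('x \<Rightarrow> 'g measure) \<Rightarrow> 'g \<Rightarrow> 'g measure" where
  "conv_kernel \<theta> g = density (distr (\<theta> (tgt G g)) (arr G) (\<lambda>h. gmul G (ginv G h) g))
     (\<lambda>_. ennreal (weight \<theta> (tgt G g)))"

lemma weight_bounded_measurable:
  assumes \<theta>: "borel_system (obj G) (arr G) (fib G) \<theta>"
  shows "weight \<theta> \<in> bounded_measurable (obj G)"
proof (rule bounded_measurableI)
  have "(\<lambda>x. emeasure (\<theta> x) (space (arr G) \<inter> space (\<theta> x))) \<in> borel_measurable (obj G)"
    by (rule borel_system_emeasure_measurable[OF \<theta> sets.top])
  then have "(\<lambda>x. measure (\<theta> x) (space (arr G) \<inter> space (\<theta> x))) \<in> borel_measurable (obj G)"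
    unfolding measure_def by (rule borel_measurable_enn2real)
  moreover have "space (arr G) \<inter> space (\<theta> x) = space (\<theta> x)" if "x \<in> space (obj G)" for x
    using borel_system_sets(2)[OF \<theta> that] by auto
  ultimately have "(\<lambda>x. measure (\<theta> x) (space (\<theta> x))) \<in> borel_measurable (obj G)"
    by (simp cong: measurable_cong)
  then show "weight \<theta> \<in> borel_measurable (obj G)"
    unfolding weight_def[abs_def] by measurable
  show "\<bar>weight \<theta> x\<bar> \<le> 1" for x
    using weight_pos[of \<theta> x] by simp
qed

context
  fixes \<theta> :: "'x \<Rightarrow> 'g measure"
  assumes \<theta>: "finite_ac_system G lam \<theta>"
begin

lemma \<theta>_system: "borel_system (obj G) (arr G) (fib G) \<theta>"
  using \<theta> by (simp add: finite_ac_system_def)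

lemma \<theta>_finite: "x \<in> space (obj G) \<Longrightarrow> finite_measure (\<theta> x)"
  using \<theta> by (simp add: finite_ac_system_def)

lemma \<theta>_sets:
  assumes "x \<in> space (obj G)"
  shows "sets (\<theta> x) = sets (restrict_space (arr G) (fib G x))" "space (\<theta> x) = fib G x"
  using borel_system_sets[OF \<theta>_system assms] by (simp_all add: fib_space)

lemma division_measurable_\<theta>:
  assumes g: "g \<in> space (arr G)"
  shows "(\<lambda>h. gmul G (ginv G h) g) \<in> measurable (\<theta> (tgt G g)) (arr G)"
  using g ginv_simps[OF g] \<theta>_sets
  by (intro division_measurable_left[of _ "tgt G g"]) (auto simp: fib_def)

lemma emeasure_conv_kernel:
  assumes g: "g \<in> space (arr G)" and A: "A \<in> sets (arr G)"
  shows "emeasure (conv_kernel \<theta> g) A =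
    ennreal (weight \<theta> (tgt G g)) * emeasure (\<theta> (tgt G g)) {h \<in> fib G (tgt G g). gmul G (ginv G h) g \<in> A}"
proof -
  have "(\<lambda>h. gmul G (ginv G h) g) -` A \<inter> space (\<theta> (tgt G g)) =
      {h \<in> fib G (tgt G g). gmul G (ginv G h) g \<in> A}"
    using \<theta>_sets(2) ginv_simps[OF g] by auto
  with A show ?thesis
    unfolding conv_kernel_def
    by (simp add: emeasure_density_const emeasure_distr[OF division_measurable_\<theta>[OF g]])
qed

lemma markov_op_conv_kernel:
  assumes g: "g \<in> space (arr G)" and f: "f \<in> borel_measurable (arr G)"
  shows "markov_op (conv_kernel \<theta>) f g = weight \<theta> (tgt G g) * conv_arr G \<theta> f g"
  unfolding markov_op_def conv_kernel_def conv_arr_def using f less_imp_le[OF weight_pos(1)]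
  by (subst integral_real_density) (auto simp: integral_distr[OF division_measurable_\<theta>[OF g] f])

lemma weight_mass:
  assumes x: "x \<in> space (obj G)"
  shows "ennreal (weight \<theta> x) * emeasure (\<theta> x) A \<le> 1"
proof -
  interpret finite_measure "\<theta> x" by (rule \<theta>_finite[OF x])
  have "weight \<theta> x * measure (\<theta> x) A \<le> weight \<theta> x * measure (\<theta> x) (space (\<theta> x))"
    using less_imp_le[OF weight_pos(1)] by (intro mult_left_mono bounded_measure)
  also have "\<dots> \<le> 1"
    by (simp add: weight_def divide_simps add_pos_nonneg)
  finally show ?thesis
    using less_imp_le[OF weight_pos(1)]
    by (simp add: emeasure_eq_measure ennreal_mult[symmetric])
qed

lemma scaled_system_kernel:
  "(\<lambda>x. density (push (arr G) \<theta> x) (\<lambda>_. ennreal (weight \<theta> x)))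
    \<in> measurable (obj G) (subprob_algebra (arr G))" (is "?\<Theta> \<in> _")
  and emeasure_scaled_system: "x \<in> space (obj G) \<Longrightarrow> A \<in> sets (arr G) \<Longrightarrow>
    emeasure (density (push (arr G) \<theta> x) (\<lambda>_. ennreal (weight \<theta> x))) A =
      ennreal (weight \<theta> x) * emeasure (\<theta> x) (A \<inter> space (\<theta> x))"
proof -
  have em: "emeasure (?\<Theta> x) A = ennreal (weight \<theta> x) * emeasure (\<theta> x) (A \<inter> space (\<theta> x))"
    if "x \<in> space (obj G)" "A \<in> sets (arr G)" for x A
    using that by (simp add: emeasure_density_const emeasure_push[OF \<theta>_system])
  then show "x \<in> space (obj G) \<Longrightarrow> A \<in> sets (arr G) \<Longrightarrow> emeasure (?\<Theta> x) A =
      ennreal (weight \<theta> x) * emeasure (\<theta> x) (A \<inter> space (\<theta> x))" .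
  show "?\<Theta> \<in> measurable (obj G) (subprob_algebra (arr G))"
  proof (rule measurable_subprob_algebra)
    fix x assume x: "x \<in> space (obj G)"
    show "subprob_space (?\<Theta> x)"
    proof (rule subprob_spaceI)
      show "emeasure (?\<Theta> x) (space (?\<Theta> x)) \<le> 1"
        using em[OF x sets.top] weight_mass[OF x] by simp
      obtain g where "g \<in> fib G x" using haar_fiber_nontrivial[OF x, of "\<lambda>_. True"] by auto
      then show "space (?\<Theta> x) \<noteq> {}" by (auto simp: fib_def)
    qed
  next
    fix A assume A: "A \<in> sets (arr G)"
    have "(\<lambda>x. ennreal (weight \<theta> x) * emeasure (\<theta> x) (A \<inter> space (\<theta> x))) \<in> borel_measurable (obj G)"
      using bounded_measurable_measurable[OF weight_bounded_measurable[OF \<theta>_system]]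
        borel_system_emeasure_measurable[OF \<theta>_system A] by measurable
    then show "(\<lambda>x. emeasure (?\<Theta> x) A) \<in> borel_measurable (obj G)"
      using em[OF _ A] by (simp cong: measurable_cong)
  qed simp
qed

text \<open>
  The function \<open>g \<mapsto> \<theta>\<^bsup>t(g)\<^esup> {h. h\<^sup>-\<^sup>1 g \<in> A}\<close> is only given through a set that is measurable relative to
  the pairs with a common target. As \<open>\<theta>\<^bsup>t(g)\<^esup>\<close> sees no other pairs, that set can be replaced by a
  measurable set \<open>S\<close> of the full product, for which joint measurability of kernels applies.
\<close>

lemma conv_kernel_measurable: "conv_kernel \<theta> \<in> measurable (arr G) (subprob_algebra (arr G))"
proof (rule measurable_subprob_algebra)
  fix g assume g: "g \<in> space (arr G)"
  show "subprob_space (conv_kernel \<theta> g)"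
  proof (rule subprob_spaceI)
    have sp: "space (conv_kernel \<theta> g) = space (arr G)" by (simp add: conv_kernel_def)
    show "emeasure (conv_kernel \<theta> g) (space (conv_kernel \<theta> g)) \<le> 1"
      unfolding sp emeasure_conv_kernel[OF g sets.top]
      using ginv_simps[OF g] by (intro weight_mass)
    show "space (conv_kernel \<theta> g) \<noteq> {}" using g sp by auto
  qed
next
  fix A assume A: "A \<in> sets (arr G)"
  let ?D = "{(g, h). tgt G h = tgt G g}"
  let ?R = "restrict_space (arr G \<Otimes>\<^sub>M arr G) ?D"
  let ?\<Theta> = "\<lambda>x. density (push (arr G) \<theta> x) (\<lambda>_. ennreal (weight \<theta> x))"
  have "(\<lambda>(g, h). gmul G (ginv G h) g) -` A \<inter> space ?R \<in> sets ?R"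
    by (rule measurable_sets[OF division_measurable A])
  then obtain S where S: "S \<in> sets (arr G \<Otimes>\<^sub>M arr G)"
    and eq: "(\<lambda>(g, h). gmul G (ginv G h) g) -` A \<inter> space ?R = ?D \<inter> S"
    by (auto simp: sets_restrict_space)
  have Ssub: "S \<subseteq> space (arr G) \<times> space (arr G)"
    using sets.sets_into_space[OF S] by (simp add: space_pair_measure)
  then have "(SIGMA g:space (arr G). {h. (g, h) \<in> S}) = S" by auto
  with S have "(SIGMA g:space (arr G). {h. (g, h) \<in> S}) \<in> sets (arr G \<Otimes>\<^sub>M arr G)" by simp
  from emeasure_measurable_subprob_algebra2[OF this measurable_compose[OF tgt_measurable scaled_system_kernel]]
  have "(\<lambda>g. emeasure (?\<Theta> (tgt G g)) {h. (g, h) \<in> S}) \<in> borel_measurable (arr G)" .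
  moreover have "emeasure (?\<Theta> (tgt G g)) {h. (g, h) \<in> S} = emeasure (conv_kernel \<theta> g) A"
    if g: "g \<in> space (arr G)" for g
  proof -
    have x: "tgt G g \<in> space (obj G)" using ginv_simps[OF g] by simp
    have "{h. (g, h) \<in> S} = Pair g -` S" by auto
    then have "{h. (g, h) \<in> S} \<in> sets (arr G)" using sets_Pair1[OF S] by simp
    then have "emeasure (?\<Theta> (tgt G g)) {h. (g, h) \<in> S} =
        ennreal (weight \<theta> (tgt G g)) * emeasure (\<theta> (tgt G g)) ({h. (g, h) \<in> S} \<inter> fib G (tgt G g))"
      using emeasure_scaled_system[OF x] \<theta>_sets(2)[OF x] by simp
    also have "{h. (g, h) \<in> S} \<inter> fib G (tgt G g) = {h \<in> fib G (tgt G g). gmul G (ginv G h) g \<in> A}"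
    proof (intro set_eqI)
      fix h
      have "(g, h) \<in> ?D \<inter> S \<longleftrightarrow> gmul G (ginv G h) g \<in> A" if "h \<in> fib G (tgt G g)"
        unfolding eq[symmetric] using that g
        by (auto simp: space_restrict_space space_pair_measure fib_def)
      then show "h \<in> {h. (g, h) \<in> S} \<inter> fib G (tgt G g) \<longleftrightarrow>
          h \<in> {h \<in> fib G (tgt G g). gmul G (ginv G h) g \<in> A}"
        by (auto simp: fib_def)
    qed
    also have "ennreal (weight \<theta> (tgt G g)) * emeasure (\<theta> (tgt G g)) \<dots> = emeasure (conv_kernel \<theta> g) A"
      by (rule emeasure_conv_kernel[OF g A, symmetric])
    finally show ?thesis .
  qed
  ultimately show "(\<lambda>g. emeasure (conv_kernel \<theta> g) A) \<in> borel_measurable (arr G)"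
    by (simp cong: measurable_cong)
qed (simp add: conv_kernel_def)

text \<open>
  Let \<open>N\<close> be null. By quasi-invariance \<open>N\<close> is null in the fiber over \<open>src h\<close> for almost every \<open>h\<close>, so by
  left invariance \<open>h N\<close> is null in the fiber over \<open>x = tgt h\<close>; as \<open>\<theta> x\<close> is absolutely continuous, this
  holds for \<open>\<theta> x\<close>-almost every \<open>h\<close>. Exchanging quantifiers by Fubini, for almost every \<open>g\<close> in the fiber
  the set of \<open>h\<close> with \<open>h\<^sup>-\<^sup>1 g \<in> N\<close> is \<open>\<theta> x\<close>-null.
\<close>

lemma conv_kernel_null_preserving:
  assumes sf: "sigma_finite_measure m"
  shows "null_preserving_kernel m (conv_kernel \<theta>)"
  unfolding null_preserving_kernel_def
proof
  show "conv_kernel \<theta> \<in> measurable m (subprob_algebra m)"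
    using conv_kernel_measurable
    by (simp cong: measurable_cong_sets subprob_algebra_cong)
  show "\<forall>N\<in>null_sets m. AE g in m. emeasure (conv_kernel \<theta> g) N = 0"
  proof
    fix N assume N: "N \<in> null_sets m"
    then have NA: "N \<in> sets (arr G)" by auto
    have cN: "{g \<in> space (arr G). g \<notin> N} \<in> sets (arr G)"
      using sets.compl_sets[OF NA] by (rule back_subst[where P = "\<lambda>A. A \<in> sets (arr G)"]) auto
    let ?Q = "\<lambda>x. AE g in lam x. g \<notin> N"
    have Qm: "{x \<in> space (obj G). ?Q x} \<in> sets (obj G)"
      by (rule borel_system_AE_measurable(1)[OF lam cN])
    have "AE g in m. g \<notin> N" using N by (rule AE_not_in)
    then have "AE x in \<mu>. ?Q x"
      using AE_integrate_system[OF lam sets_\<mu> cN] by simp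
    from AE_haar_src[OF Qm this] have srcQ: "AE g in m. ?Q (src G g)" .
    have "{g \<in> space (arr G). ?Q (src G g)} = src G -` {x \<in> space (obj G). ?Q x} \<inter> space (arr G)"
      using ginv_simps by auto
    then have "{g \<in> space (arr G). ?Q (src G g)} \<in> sets (arr G)"
      using measurable_sets[OF src_measurable Qm] by simp
    from srcQ[unfolded AE_integrate_system[OF lam sets_\<mu> this]]
    have fiberQ: "AE x in \<mu>. AE h in lam x. ?Q (src G h)" .
    have Zm: "{g \<in> space (arr G). emeasure (conv_kernel \<theta> g) N = 0} \<in> sets (arr G)"
      using measurable_emeasure_kernel[OF conv_kernel_measurable NA] by measurable
    have "AE x in \<mu>. AE g in lam x. emeasure (conv_kernel \<theta> g) N = 0"
      using fiberQ AE_sigma_finite_system[OF lam sets_\<mu> sf] AE_space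
    proof eventually_elim
      case (elim x)
      then have x: "x \<in> space (obj G)" by (simp add: space_\<mu>)
      note sl = borel_system_sets[OF lam x, unfolded fib_space]
      have "absolutely_continuous (lam x) (\<theta> x)"
        using \<theta> x by (simp add: finite_ac_system_def)
      from absolutely_continuous_AE[OF _ this elim(1)]
      have "AE h in \<theta> x. ?Q (src G h)" using \<theta>_sets[OF x] sl by simp
      then have 1: "AE h in \<theta> x. AE g in lam x. gmul G (ginv G h) g \<notin> N"
        using AE_space
      proof eventually_elim
        case (elim h)
        then have "h \<in> fib G x" using \<theta>_sets[OF x] by simp
        from AE_haar_translate[OF this cN elim(1)] show ?case .
      qed
      interpret l: sigma_finite_measure "lam x" by (rule elim)
      interpret t: finite_measure "\<theta> x" by (rule \<theta>_finite[OF x])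
      interpret pair_sigma_finite "lam x" "\<theta> x" ..
      have d: "(\<lambda>(g, h). gmul G (ginv G h) g) \<in> measurable (lam x \<Otimes>\<^sub>M \<theta> x) (arr G)"
        using sl \<theta>_sets[OF x] by (intro division_measurable_fibers[of _ x]) auto
      have "{p \<in> space (lam x \<Otimes>\<^sub>M \<theta> x). gmul G (ginv G (snd p)) (fst p) \<notin> N} =
          (\<lambda>(g, h). gmul G (ginv G h) g) -` {g \<in> space (arr G). g \<notin> N} \<inter> space (lam x \<Otimes>\<^sub>M \<theta> x)"
        using measurable_space[OF d] by (auto simp: case_prod_beta)
      also have "\<dots> \<in> sets (lam x \<Otimes>\<^sub>M \<theta> x)"
        by (rule measurable_sets[OF d cN])
      finally have "AE g in lam x. AE h in \<theta> x. gmul G (ginv G h) g \<notin> N"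
        using 1 AE_commute[of "\<lambda>g h. gmul G (ginv G h) g \<notin> N"] by simp
      then show ?case
        using AE_space
      proof eventually_elim
        case (elim g)
        then have g: "g \<in> space (arr G)" "tgt G g = x" using sl by (auto simp: fib_def)
        have "{h \<in> fib G x. gmul G (ginv G h) g \<in> N} =
            (\<lambda>h. gmul G (ginv G h) g) -` N \<inter> space (\<theta> x)"
          using \<theta>_sets[OF x] by auto
        also have "\<dots> \<in> sets (\<theta> x)"
          using measurable_sets[OF division_measurable_\<theta>[OF g(1)] NA] g by simp
        finally have "emeasure (\<theta> x) {h \<in> fib G x. gmul G (ginv G h) g \<in> N} = 0"
          using elim(1) \<theta>_sets(2)[OF x] by (subst AE_iff_measurable[symmetric]) auto
        then show ?case
          using emeasure_conv_kernel[OF g(1) NA] g by simp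
      qed
    qed
    then show "AE g in m. emeasure (conv_kernel \<theta> g) N = 0"
      using AE_integrate_system[OF lam sets_\<mu> Zm] by simp
  qed
qed

end

end

section \<open>The mean of a Liouville groupoid\<close>

locale liouville_groupoid = measured_groupoid_space G lam \<mu>
  for G :: "('x, 'g) groupoid_data" and lam :: "'x \<Rightarrow> 'g measure" and \<mu> :: "'x measure" +
  fixes \<pi> :: "'g \<Rightarrow> 'g measure" and U :: "nat filter"
  assumes invariant: "invariant_markov_on_measured G lam \<mu> \<pi>"
    and liouville: "fiberwise_liouville lam \<mu> \<pi>"
    and generalized_limit: "generalized_limit U"
begin

abbreviation "K \<equiv> push (arr G) \<pi>"

lemma \<pi>_system: "borel_system (arr G) (arr G) (\<lambda>g. fib G (tgt G g)) \<pi>"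
  and \<pi>_prob: "g \<in> space (arr G) \<Longrightarrow> prob_space (\<pi> g)"
  and \<pi>_translate: "(h, g) \<in> composable G \<Longrightarrow> \<pi> (gmul G h g) = translate G h (\<pi> g)"
  using invariant
  by (auto simp: invariant_markov_on_measured_def invariant_markov_def transition_probabilities_def)

lemma sigma_finite_m: "sigma_finite_measure m"
  using invariant by (simp add: invariant_markov_on_measured_def adapted_def)

lemma K_prob:
  assumes "g \<in> space (arr G)" shows "prob_space (K g)"
  unfolding push_def
  by (intro prob_space.prob_space_distr[OF \<pi>_prob[OF assms]] borel_system_measurable[OF \<pi>_system assms])
    simp

lemma markov_op_K:
  assumes "g \<in> space (arr G)" "f \<in> borel_measurable (arr G)"
  shows "markov_op K f g = markov_op \<pi> f g"
  using markov_op_push[OF \<pi>_system assms] by (simp add: markov_op_def)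

lemma K_null_preserving: "null_preserving_kernel m K"
  unfolding null_preserving_kernel_def
proof
  have "K \<in> measurable (arr G) (subprob_algebra (arr G))"
  proof (rule measurable_subprob_algebra)
    show "subprob_space (K g)" if "g \<in> space (arr G)" for g
      using K_prob[OF that] by (rule prob_space_imp_subprob_space)
    show "(\<lambda>g. emeasure (K g) A) \<in> borel_measurable (arr G)" if "A \<in> sets (arr G)" for A
      using borel_system_emeasure_measurable[OF \<pi>_system that] emeasure_push[OF \<pi>_system _ that]
      by (simp cong: measurable_cong)
  qed simp
  then show "K \<in> measurable m (subprob_algebra m)"
    by (simp cong: measurable_cong_sets subprob_algebra_cong)
  show "\<forall>N\<in>null_sets m. AE g in m. emeasure (K g) N = 0"
  proof
    fix N assume N: "N \<in> null_sets m"
    then have NA: "N \<in> sets (arr G)" by auto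
    have "integrate_system m \<pi> m = integrate_system (arr G) \<pi> m"
      by (simp add: integrate_system_def)
    then have "absolutely_continuous m (integrate_system (arr G) \<pi> m)"
      using invariant by (simp add: invariant_markov_on_measured_def adapted_def)
    with N have "emeasure (integrate_system (arr G) \<pi> m) N = 0"
      by (auto simp: absolutely_continuous_def)
    then have "(\<integral>\<^sup>+ g. emeasure (\<pi> g) (N \<inter> space (\<pi> g)) \<partial>m) = 0"
      by (subst (asm) emeasure_integrate_system[OF \<pi>_system _ NA]) simp_all
    then have "AE g in m. emeasure (\<pi> g) (N \<inter> space (\<pi> g)) = 0"
      using borel_system_emeasure_measurable[OF \<pi>_system NA]
      by (subst (asm) nn_integral_0_iff_AE) (simp_all cong: measurable_cong_sets)
    then show "AE g in m. emeasure (K g) N = 0"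
      using AE_space by eventually_elim (simp add: emeasure_push[OF \<pi>_system _ NA])
  qed
qed

sublocale averaging: ergodic_averaging m K U
  by (intro ergodic_averaging.intro ergodic_averaging_axioms.intro
      sigma_finite_m K_null_preserving generalized_limit)

abbreviation "P \<equiv> markov_op K"

text \<open>
  Every transition probability stays on the fiber of its starting point, so functions of the target
  behave like constants.
\<close>

lemma markov_op_K_invariant_factor:
  assumes f: "f \<in> borel_measurable (arr G)" and g: "g \<in> space (arr G)"
    and c: "c \<in> borel_measurable (obj G)"
  shows "P (\<lambda>k. c (tgt G k) * f k) g = c (tgt G g) * P f g"
proof -
  have "(\<lambda>k. c (tgt G k) * f k) \<in> borel_measurable (arr G)"
    using f measurable_compose[OF tgt_measurable c] by simp
  then have "P (\<lambda>k. c (tgt G k) * f k) g = (\<integral>k. c (tgt G k) * f k \<partial>\<pi> g)"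
    by (rule markov_op_push[OF \<pi>_system g])
  also have "\<dots> = (\<integral>k. c (tgt G g) * f k \<partial>\<pi> g)"
    using borel_system_sets(2)[OF \<pi>_system g]
    by (intro Bochner_Integration.integral_cong) (auto simp: fib_def)
  also have "\<dots> = c (tgt G g) * P f g"
    using markov_op_push[OF \<pi>_system g f] by simp
  finally show ?thesis .
qed

text \<open>
  Convolution acts by left translations inside the fibers and the transition probabilities are
  invariant under them: \<open>\<integral> f(h\<^sup>-\<^sup>1 k) d\<pi>\<^sub>g(k) = P f (h\<^sup>-\<^sup>1 g)\<close>. Fubini over \<open>\<pi>\<^sub>g\<close> and \<open>\<theta>\<^bsup>t(g)\<^esup>\<close>, both finite
  measures on the same fiber, does the rest.
\<close>

lemma markov_op_conv_kernel_commute: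
  assumes \<theta>: "finite_ac_system G lam \<theta>" and f: "f \<in> bounded_measurable m" and g: "g \<in> space (arr G)"
  shows "P (markov_op (conv_kernel \<theta>) f) g = markov_op (conv_kernel \<theta>) (P f) g"
proof -
  let ?x = "tgt G g"
  let ?w = "weight \<theta> ?x"
  have x: "?x \<in> space (obj G)" using ginv_simps[OF g] by simp
  note L = conv_kernel_null_preserving[OF \<theta> sigma_finite_m]
  obtain C where C: "f \<in> borel_measurable (arr G)" "\<And>k. k \<in> space (arr G) \<Longrightarrow> \<bar>f k\<bar> \<le> C"
    using bounded_measurableE[OF f] by (auto cong: measurable_cong_sets)
  have meas: "h \<in> borel_measurable (arr G)" if "h \<in> bounded_measurable m" for h
    using bounded_measurable_measurable[OF that] by (simp cong: measurable_cong_sets)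
  note s\<pi> = borel_system_sets[OF \<pi>_system g, unfolded fib_space]
  note s\<theta> = \<theta>_sets[OF \<theta> x]
  interpret p: prob_space "\<pi> g" by (rule \<pi>_prob[OF g])
  interpret t: finite_measure "\<theta> ?x" by (rule \<theta>_finite[OF \<theta> x])
  interpret pair_sigma_finite "\<pi> g" "\<theta> ?x" ..
  have d: "(\<lambda>(k, h). gmul G (ginv G h) k) \<in> measurable (\<pi> g \<Otimes>\<^sub>M \<theta> ?x) (arr G)"
    using s\<pi> s\<theta> by (intro division_measurable_fibers[of _ ?x]) auto
  have "integrable (\<pi> g \<Otimes>\<^sub>M \<theta> ?x) (\<lambda>p. f ((\<lambda>(k, h). gmul G (ginv G h) k) p))"
  proof -
    interpret pt: finite_measure "\<pi> g \<Otimes>\<^sub>M \<theta> ?x"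
      by (intro finite_measure_pair_measure p.finite_measure_axioms t.finite_measure_axioms)
    show ?thesis
      using measurable_space[OF d] C(2)
      by (intro pt.integrable_const_bound[of _ C] measurable_compose[OF d C(1)] AE_I2) auto
  qed
  then have int: "integrable (\<pi> g \<Otimes>\<^sub>M \<theta> ?x) (\<lambda>(k, h). f (gmul G (ginv G h) k))"
    by (simp add: case_prod_beta')
  have "P (markov_op (conv_kernel \<theta>) f) g = (\<integral>k. markov_op (conv_kernel \<theta>) f k \<partial>\<pi> g)"
    by (intro markov_op_push[OF \<pi>_system g] meas markov_op_bounded_measurable[OF L f])
  also have "\<dots> = (\<integral>k. ?w * (\<integral>h. f (gmul G (ginv G h) k) \<partial>\<theta> ?x) \<partial>\<pi> g)"
  proof (rule Bochner_Integration.integral_cong[OF refl])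
    fix k assume "k \<in> space (\<pi> g)"
    then have k: "k \<in> space (arr G)" "tgt G k = ?x" using s\<pi> by (auto simp: fib_def)
    show "markov_op (conv_kernel \<theta>) f k = ?w * (\<integral>h. f (gmul G (ginv G h) k) \<partial>\<theta> ?x)"
      using markov_op_conv_kernel[OF \<theta> k(1) C(1)] k(2) by (simp add: conv_arr_def)
  qed
  also have "\<dots> = ?w * (\<integral>k. \<integral>h. f (gmul G (ginv G h) k) \<partial>\<theta> ?x \<partial>\<pi> g)"
    by simp
  also have "\<dots> = ?w * (\<integral>h. \<integral>k. f (gmul G (ginv G h) k) \<partial>\<pi> g \<partial>\<theta> ?x)"
    using Fubini_integral[OF int] by simp
  also have "\<dots> = ?w * (\<integral>h. P f (gmul G (ginv G h) g) \<partial>\<theta> ?x)"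
  proof (intro arg_cong2[where f = "(*)"] refl Bochner_Integration.integral_cong)
    fix h assume "h \<in> space (\<theta> ?x)"
    then have h: "h \<in> space (arr G)" "tgt G h = ?x" using s\<theta> by (auto simp: fib_def)
    note dv = division[OF h(1) g h(2)]
    let ?R = "restrict_space (arr G) (fib G (tgt G (ginv G h)))"
    have m1: "gmul G (ginv G h) \<in> measurable (\<pi> g) ?R"
      using gmul_measurable_fib[OF borel_groupoid ginv_simps(1)[OF h(1)]] ginv_simps[OF h(1)] h s\<pi>
      by (simp cong: measurable_cong_sets)
    have "P f (gmul G (ginv G h) g) = (\<integral>k. f k \<partial>\<pi> (gmul G (ginv G h) g))"
      by (rule markov_op_push[OF \<pi>_system dv(2) C(1)])
    also have "\<dots> = (\<integral>k. f k \<partial>distr (\<pi> g) ?R (gmul G (ginv G h)))"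
      by (simp add: \<pi>_translate[OF dv(1)] translate_def)
    also have "\<dots> = (\<integral>k. f (gmul G (ginv G h) k) \<partial>\<pi> g)"
      by (rule integral_distr[OF m1 measurable_restrict_space1[OF C(1)]])
    finally show "(\<integral>k. f (gmul G (ginv G h) k) \<partial>\<pi> g) = P f (gmul G (ginv G h) g)" by simp
  qed
  also have "\<dots> = markov_op (conv_kernel \<theta>) (P f) g"
    using markov_op_conv_kernel[OF \<theta> g meas[OF markov_op_bounded_measurable[OF K_null_preserving f]]]
    by (simp add: conv_arr_def)
  finally show ?thesis .
qed

text \<open>
  By the Liouville property a harmonic function is constant on almost every fiber. Integrating it
  against the normalized Haar density \<open>p\<close> selects this constant in a measurable way.
\<close>

lemma harmonic_factors_through_tgt:
  assumes F: "F \<in> bounded_measurable m" and harm: "AE g in m. P F g = F g"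
  obtains \<phi> where "\<phi> \<in> bounded_measurable (obj G)" "AE g in m. F g = \<phi> (tgt G g)"
proof -
  obtain C where C: "F \<in> borel_measurable (arr G)" "0 \<le> C" "\<And>g. g \<in> space (arr G) \<Longrightarrow> \<bar>F g\<bar> \<le> C"
    using bounded_measurableE[OF F] by (auto cong: measurable_cong_sets)
  have PF: "P F \<in> borel_measurable (arr G)"
    using bounded_measurable_measurable[OF markov_op_bounded_measurable[OF K_null_preserving F]]
    by (simp cong: measurable_cong_sets)
  obtain p :: "'g \<Rightarrow> ennreal" where p: "p \<in> borel_measurable (arr G)"
    "\<And>x. x \<in> space (obj G) \<Longrightarrow> (\<integral>\<^sup>+ g. p g \<partial>lam x) = 1"
    using proper by metis
  \<comment> \<open>The shift by \<open>C\<close> keeps the integrand nonnegative; the truncation in \<open>\<phi>\<close> gives a bound on all fibers.\<close>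
  define \<psi> where "\<psi> = (\<lambda>x. enn2real (\<integral>\<^sup>+ g. ennreal (F g + C) * p g \<partial>lam x) - C)"
  define \<phi> where "\<phi> = (\<lambda>x. max (- C) (min C (\<psi> x)))"
  have "(\<lambda>x. \<integral>\<^sup>+ g. ennreal (F g + C) * p g \<partial>lam x) \<in> borel_measurable (obj G)"
    using lam C(1) p(1) by (auto simp: borel_system_def)
  then have "\<psi> \<in> borel_measurable (obj G)" by (simp add: \<psi>_def)
  then have \<phi>m: "\<phi> \<in> borel_measurable (obj G)" unfolding \<phi>_def by measurable
  have \<phi>: "\<phi> \<in> bounded_measurable (obj G)"
    using C(2) by (intro bounded_measurableI[OF \<phi>m, of C]) (auto simp: \<phi>_def)
  have "{g \<in> space (arr G). P F g = F g} \<in> sets (arr G)"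
    using PF C(1) by measurable
  then have fib_harm: "AE x in \<mu>. AE g in lam x. P F g = F g"
    using AE_integrate_system[OF lam sets_\<mu>] harm by simp
  have "AE x in \<mu>. AE g in lam x. F g = \<phi> (tgt G g)"
    using fib_harm liouville[unfolded fiberwise_liouville_def] AE_space
  proof eventually_elim
    case (elim x)
    then have x: "x \<in> space (obj G)" by (simp add: space_\<mu>)
    note sl = borel_system_sets[OF lam x, unfolded fib_space]
    have "F \<in> Linf (lam x)"
      using borel_system_measurable[OF lam x C(1)] C(3) sl
      by (auto simp: Linf_def fib_def intro!: exI[of _ C] AE_I2)
    moreover have "AE g in lam x. markov_op \<pi> F g = F g"
      using elim(1) AE_space
      by eventually_elim (use sl in \<open>auto simp: fib_def markov_op_K[OF _ C(1)]\<close>)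
    ultimately obtain c where c: "AE g in lam x. F g = c"
      using elim(2) unfolding liouville_def by blast
    obtain g where g: "g \<in> fib G x" "F g = c" using haar_fiber_nontrivial[OF x c] .
    then have cC: "\<bar>c\<bar> \<le> C" using C(3) by (auto simp: fib_def)
    have "(\<integral>\<^sup>+ g. ennreal (F g + C) * p g \<partial>lam x) = (\<integral>\<^sup>+ g. ennreal (c + C) * p g \<partial>lam x)"
      using c by (intro nn_integral_cong_AE) (auto elim: eventually_mono)
    also have "\<dots> = ennreal (c + C)"
      using nn_integral_cmult[OF borel_system_measurable[OF lam x p(1)]] p(2)[OF x] by simp
    finally have "\<psi> x = c" using cC by (simp add: \<psi>_def)
    then have "\<phi> x = c" using cC by (simp add: \<phi>_def)
    moreover have "AE g in lam x. tgt G g = x"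
      using sl by (intro AE_I2) (auto simp: fib_def)
    ultimately show ?case
      using c by (auto elim: eventually_elim2)
  qed
  moreover have "{g \<in> space (arr G). F g = \<phi> (tgt G g)} \<in> sets (arr G)"
    using C(1) measurable_compose[OF tgt_measurable \<phi>m] by measurable
  ultimately have "AE g in m. F g = \<phi> (tgt G g)"
    using AE_integrate_system[OF lam sets_\<mu>] by simp
  with \<phi> show ?thesis by (rule that)
qed

text \<open>
  The mean as a relation: \<open>\<phi>\<close> is a version of the image of \<open>f\<close>. The averages are taken of a bounded
  representative \<open>f'\<close>, because an essentially bounded \<open>f\<close> need not be integrable against every
  transition probability.
\<close>

definition mean_value :: "('g \<Rightarrow> real) \<Rightarrow> ('x \<Rightarrow> real) \<Rightarrow> bool" where
  "mean_value f \<phi> \<longleftrightarrow> \<phi> \<in> bounded_measurable (obj G) \<and>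
     (\<exists>f'\<in>bounded_measurable m. (AE g in m. f g = f' g) \<and>
        weak_limit U m (averaging.average f') (\<lambda>g. \<phi> (tgt G g)))"

lemma mean_valueI:
  assumes "f' \<in> bounded_measurable m" "AE g in m. f g = f' g"
    "weak_limit U m (averaging.average f') (\<lambda>g. \<phi> (tgt G g))" "\<phi> \<in> bounded_measurable (obj G)"
  shows "mean_value f \<phi>"
  using assms unfolding mean_value_def by blast

lemma pullback_bounded:
  "\<phi> \<in> bounded_measurable (obj G) \<Longrightarrow> (\<lambda>g. \<phi> (tgt G g)) \<in> bounded_measurable m"
  unfolding bounded_measurable_m by (rule bounded_measurable_comp[OF _ tgt_measurable])

lemma mean_value_exists:
  assumes "f \<in> Linf m"
  shows "\<exists>\<phi>. mean_value f \<phi>"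
proof -
  obtain f' where f': "f' \<in> bounded_measurable m" "AE g in m. f g = f' g"
    using Linf_bounded_representative[OF assms] by blast
  obtain F where F: "F \<in> bounded_measurable m" "weak_limit U m (averaging.average f') F"
    using averaging.averages_have_weak_limit[OF f'(1)] by blast
  obtain \<phi> where \<phi>: "\<phi> \<in> bounded_measurable (obj G)" "AE g in m. F g = \<phi> (tgt G g)"
    using harmonic_factors_through_tgt[OF F(1) averaging.weak_limit_of_averages_invariant[OF f'(1) F]] .
  have "weak_limit U m (averaging.average f') (\<lambda>g. \<phi> (tgt G g))"
    by (rule weak_limit_cong_AE[OF F(2) \<phi>(2) F(1) pullback_bounded[OF \<phi>(1)]])
  with \<phi>(1) f' show ?thesis unfolding mean_value_def by blast
qed

lemma mean_value_mono:
  assumes "mean_value f \<phi>" "mean_value h \<psi>" and le: "AE g in m. f g \<le> h g"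
  shows "AE x in \<mu>. \<phi> x \<le> \<psi> x"
proof -
  obtain f' h' where \<phi>: "\<phi> \<in> bounded_measurable (obj G)" "\<psi> \<in> bounded_measurable (obj G)"
    and f': "f' \<in> bounded_measurable m" "AE g in m. f g = f' g"
      "weak_limit U m (averaging.average f') (\<lambda>g. \<phi> (tgt G g))"
    and h': "h' \<in> bounded_measurable m" "AE g in m. h g = h' g"
      "weak_limit U m (averaging.average h') (\<lambda>g. \<psi> (tgt G g))"
    using assms(1,2) unfolding mean_value_def by blast
  have "AE g in m. f' g \<le> h' g"
    using le f'(2) h'(2) by eventually_elim simp
  then have "AE g in m. averaging.average f' n g \<le> averaging.average h' n g" for n
    by (rule averaging.average_mono_AE[OF f'(1) h'(1)])
  then have "AE g in m. \<phi> (tgt G g) \<le> \<psi> (tgt G g)"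
    by (rule averaging.weak_limit_mono[OF generalized_limit f'(3) pullback_bounded[OF \<phi>(1)]
        averaging.average_bounded_measurable[OF f'(1)] h'(3) pullback_bounded[OF \<phi>(2)]
        averaging.average_bounded_measurable[OF h'(1)]])
  moreover have "{x \<in> space (obj G). \<phi> x \<le> \<psi> x} \<in> sets (obj G)"
    using \<phi>[THEN bounded_measurable_measurable] by measurable
  ultimately show ?thesis using AE_haar_tgt_iff[of "\<lambda>x. \<phi> x \<le> \<psi> x"] by simp
qed

lemma mean_value_cong:
  assumes "mean_value f \<phi>" "mean_value h \<psi>" and eq: "AE g in m. f g = h g"
  shows "AE x in \<mu>. \<phi> x = \<psi> x"
proof -
  have "AE x in \<mu>. \<phi> x \<le> \<psi> x"
    using eq by (intro mean_value_mono[OF assms(1,2)]) (auto elim: eventually_mono)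
  moreover have "AE x in \<mu>. \<psi> x \<le> \<phi> x"
    using eq by (intro mean_value_mono[OF assms(2,1)]) (auto elim: eventually_mono)
  ultimately show ?thesis by eventually_elim simp
qed

lemma mean_value_linear:
  assumes "mean_value f \<phi>" "mean_value h \<psi>"
  shows "mean_value (\<lambda>g. a * f g + b * h g) (\<lambda>x. a * \<phi> x + b * \<psi> x)"
proof -
  obtain f' h' where \<phi>: "\<phi> \<in> bounded_measurable (obj G)" "\<psi> \<in> bounded_measurable (obj G)"
    and f': "f' \<in> bounded_measurable m" "AE g in m. f g = f' g"
      "weak_limit U m (averaging.average f') (\<lambda>g. \<phi> (tgt G g))"
    and h': "h' \<in> bounded_measurable m" "AE g in m. h g = h' g"
      "weak_limit U m (averaging.average h') (\<lambda>g. \<psi> (tgt G g))"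
    using assms unfolding mean_value_def by blast
  let ?l = "\<lambda>g. a * f' g + b * h' g"
  have "?l \<in> bounded_measurable m"
    by (intro bounded_measurable_add bounded_measurable_mult bounded_measurable_const f' h')
  moreover have "AE g in m. a * f g + b * h g = ?l g"
    using f'(2) h'(2) by eventually_elim simp
  moreover have "weak_limit U m (averaging.average ?l) (\<lambda>g. a * \<phi> (tgt G g) + b * \<psi> (tgt G g))"
    using averaging.average_linear[OF f'(1) h'(1), symmetric]
      weak_limit_linear[OF f'(3) pullback_bounded[OF \<phi>(1)]
        averaging.average_bounded_measurable[OF f'(1)] h'(3) pullback_bounded[OF \<phi>(2)]
        averaging.average_bounded_measurable[OF h'(1)]]
    by (rule weak_limit_cong)
  moreover have "(\<lambda>x. a * \<phi> x + b * \<psi> x) \<in> bounded_measurable (obj G)"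
    by (intro bounded_measurable_add bounded_measurable_mult bounded_measurable_const \<phi>)
  ultimately show ?thesis by (rule mean_valueI)
qed

lemma mean_value_one: "mean_value (\<lambda>_. 1) (\<lambda>_. 1)"
proof -
  have "weak_limit U m (averaging.average (\<lambda>_. 1)) (\<lambda>_. 1)"
    unfolding weak_limit_def
  proof
    fix \<nu> assume \<nu>: "\<nu> \<in> finite_below m"
    have "eventually (\<lambda>n. 0 < n) U"
      using generalized_limit eventually_gt_at_top[of "0 :: nat"]
      by (auto simp: generalized_limit_def le_filter_def)
    then have "\<forall>\<^sub>F n in U. (\<integral>g. averaging.average (\<lambda>_. 1) n g \<partial>\<nu>) = (\<integral>g. 1 \<partial>\<nu>)"
    proof eventually_elim
      case (elim n)
      then show ?case
        using finite_belowD(3)[OF \<nu>] averaging.average_one K_prob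
        by (intro Bochner_Integration.integral_cong) auto
    qed
    then show "((\<lambda>n. \<integral>g. averaging.average (\<lambda>_. 1) n g \<partial>\<nu>) \<longlongrightarrow> (\<integral>g. 1 \<partial>\<nu>)) U"
      by (rule tendsto_eventually)
  qed
  then show ?thesis
    unfolding mean_value_def by (auto intro!: bounded_measurable_const bexI[of _ "\<lambda>_. 1"])
qed

lemma mean_value_factor:
  assumes "mean_value f \<phi>" and c: "c \<in> bounded_measurable (obj G)" "\<And>x. 0 \<le> c x"
  shows "mean_value (\<lambda>g. c (tgt G g) * f g) (\<lambda>x. c x * \<phi> x)"
proof -
  obtain f' where \<phi>: "\<phi> \<in> bounded_measurable (obj G)"
    and f': "f' \<in> bounded_measurable m" "AE g in m. f g = f' g"
      "weak_limit U m (averaging.average f') (\<lambda>g. \<phi> (tgt G g))"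
    using assms unfolding mean_value_def by blast
  have comm: "P (\<lambda>k. c (tgt G k) * h k) g = c (tgt G g) * P h g"
    if "h \<in> bounded_measurable m" "g \<in> space m" for h g
    using that bounded_measurable_measurable[OF c(1)] bounded_measurable_measurable[OF that(1)]
    by (intro markov_op_K_invariant_factor) (simp_all cong: measurable_cong_sets)
  let ?l = "\<lambda>g. c (tgt G g) * f' g"
  have "?l \<in> bounded_measurable m"
    by (intro bounded_measurable_mult f' pullback_bounded c)
  moreover have "AE g in m. c (tgt G g) * f g = ?l g"
    using f'(2) by eventually_elim simp
  moreover have "weak_limit U m (averaging.average ?l) (\<lambda>g. c (tgt G g) * \<phi> (tgt G g))"
    using averaging.average_mult_invariant[OF comm f'(1), symmetric]
      weak_limit_mult[OF f'(3) pullback_bounded[OF \<phi>]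
        averaging.average_bounded_measurable[OF f'(1)] pullback_bounded[OF c(1)] c(2)]
    by (rule weak_limit_cong)
  moreover have "(\<lambda>x. c x * \<phi> x) \<in> bounded_measurable (obj G)"
    by (intro bounded_measurable_mult c \<phi>)
  ultimately show ?thesis by (rule mean_valueI)
qed

text \<open>
  Averaging commutes with the convolution kernel, whose operator is weak-* continuous, so the limit
  of averages of \<open>\<theta> * f\<close> is \<open>\<theta>\<close> convolved with the limit \<open>\<phi> \<circ> tgt\<close> of averages of \<open>f\<close>. Since
  \<open>tgt (h\<^sup>-\<^sup>1 g) = src h\<close>, the latter is \<open>(\<theta> * \<phi>) \<circ> tgt\<close>.
\<close>

lemma mean_value_convolution:
  assumes "mean_value f \<phi>" and f: "f \<in> borel_measurable m" and \<theta>: "finite_ac_system G lam \<theta>"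
  shows "mean_value (\<lambda>g. weight \<theta> (tgt G g) * conv_arr G \<theta> f g) (\<lambda>x. weight \<theta> x * conv_obj G \<theta> \<phi> x)"
proof -
  obtain f' where \<phi>: "\<phi> \<in> bounded_measurable (obj G)"
    and f': "f' \<in> bounded_measurable m" "AE g in m. f g = f' g"
      "weak_limit U m (averaging.average f') (\<lambda>g. \<phi> (tgt G g))"
    using assms unfolding mean_value_def by blast
  let ?L = "conv_kernel \<theta>"
  note L = conv_kernel_null_preserving[OF \<theta> sigma_finite_m]
  have fA: "f \<in> borel_measurable (arr G)" using f by (simp cong: measurable_cong_sets)
  have fA': "f' \<in> borel_measurable (arr G)"
    using bounded_measurable_measurable[OF f'(1)] by (simp cong: measurable_cong_sets)
  let ?\<Phi> = "\<lambda>g. \<phi> (tgt G g)"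
  have L\<phi>: "markov_op ?L ?\<Phi> g = weight \<theta> (tgt G g) * conv_obj G \<theta> \<phi> (tgt G g)"
    if g: "g \<in> space (arr G)" for g
  proof -
    have x: "tgt G g \<in> space (obj G)" using ginv_simps[OF g] by simp
    have "conv_arr G \<theta> ?\<Phi> g = conv_obj G \<theta> \<phi> (tgt G g)"
      unfolding conv_arr_def conv_obj_def
    proof (rule Bochner_Integration.integral_cong[OF refl])
      fix h assume "h \<in> space (\<theta> (tgt G g))"
      then show "\<phi> (tgt G (gmul G (ginv G h) g)) = \<phi> (src G h)"
        using \<theta>_sets(2)[OF \<theta> x] division(3)[OF _ g] by (auto simp: fib_def)
    qed
    then show ?thesis
      using markov_op_conv_kernel[OF \<theta> g measurable_compose[OF tgt_measurable bounded_measurable_measurable[OF \<phi>]]]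
      by simp
  qed
  have L\<Phi>: "markov_op ?L ?\<Phi> \<in> bounded_measurable m"
    by (rule markov_op_bounded_measurable[OF L pullback_bounded[OF \<phi>]])
  \<comment> \<open>Measurability on the objects is read off along the identity morphisms.\<close>
  have obj: "(\<lambda>x. weight \<theta> x * conv_obj G \<theta> \<phi> x) \<in> bounded_measurable (obj G)"
  proof -
    have "(\<lambda>x. markov_op ?L ?\<Phi> (idt G x)) \<in> bounded_measurable (obj G)"
      using L\<Phi> unfolding bounded_measurable_m by (rule bounded_measurable_comp[OF _ idt_measurable])
    then show ?thesis
      using L\<phi>[OF idt_simps(1)]
      by (simp add: bounded_measurable_def idt_simps cong: measurable_cong)
  qed
  have "AE g in m. weight \<theta> (tgt G g) * conv_arr G \<theta> f g = markov_op ?L f' g"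
    using AE_kernel[OF L f'(2)] AE_space
  proof eventually_elim
    case (elim g)
    then have g: "g \<in> space (arr G)" by simp
    have s: "sets (?L g) = sets (arr G)" by (simp add: conv_kernel_def)
    have "markov_op ?L f g = markov_op ?L f' g"
      unfolding markov_op_def using elim fA fA' s
      by (intro integral_cong_AE) (auto cong: measurable_cong_sets)
    then show ?case using markov_op_conv_kernel[OF \<theta> g fA] by simp
  qed
  moreover have "weak_limit U m (averaging.average (markov_op ?L f'))
      (\<lambda>g. weight \<theta> (tgt G g) * conv_obj G \<theta> \<phi> (tgt G g))"
  proof (rule weak_limit_cong)
    show "markov_op ?L (averaging.average f' n) g = averaging.average (markov_op ?L f') n g"
      if "g \<in> space m" for n g
      using markov_op_conv_kernel_commute[OF \<theta>] that
      by (intro averaging.average_commute[OF L _ f'(1), symmetric]) auto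
    have "weak_limit U m (\<lambda>n. markov_op ?L (averaging.average f' n)) (markov_op ?L ?\<Phi>)"
      by (rule weak_limit_markov_op[OF L f'(3) pullback_bounded[OF \<phi>]
        averaging.average_bounded_measurable[OF f'(1)]])
    then show "weak_limit U m (\<lambda>n. markov_op ?L (averaging.average f' n))
        (\<lambda>g. weight \<theta> (tgt G g) * conv_obj G \<theta> \<phi> (tgt G g))"
      by (rule weak_limit_cong_AE[OF _ _ L\<Phi> pullback_bounded[OF obj]]) (rule AE_I2, simp add: L\<phi>)
  qed
  ultimately show ?thesis
    by (rule mean_valueI[OF markov_op_bounded_measurable[OF L f'(1)] _ _ obj])
qed

lemma amenable: "amenable G lam \<mu>"
proof -
  define T where "T = (\<lambda>f. SOME \<phi>. mean_value f \<phi>)"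
  have T: "mean_value f (T f)" if "f \<in> Linf m" for f
    unfolding T_def using someI_ex[OF mean_value_exists[OF that]] .
  have const: "(\<lambda>_. c) \<in> Linf m" for c
    using bounded_measurable_const bounded_measurable_subset_Linf by blast
  have Linf_linear: "(\<lambda>g. a * f g + b * h g) \<in> Linf m" if "f \<in> Linf m" "h \<in> Linf m" for a b f h
  proof -
    obtain C D where "f \<in> borel_measurable m" "AE g in m. \<bar>f g\<bar> \<le> C"
      "h \<in> borel_measurable m" "AE g in m. \<bar>h g\<bar> \<le> D"
      using \<open>f \<in> Linf m\<close> \<open>h \<in> Linf m\<close> by (auto simp: Linf_def)
    moreover from this(2,4) have "AE g in m. \<bar>a * f g + b * h g\<bar> \<le> \<bar>a\<bar> * C + \<bar>b\<bar> * D"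
    proof eventually_elim
      case (elim g)
      have "\<bar>a * f g + b * h g\<bar> \<le> \<bar>a\<bar> * \<bar>f g\<bar> + \<bar>b\<bar> * \<bar>h g\<bar>"
        by (metis abs_mult abs_triangle_ineq)
      also have "\<dots> \<le> \<bar>a\<bar> * C + \<bar>b\<bar> * D"
        using elim by (intro add_mono mult_left_mono) auto
      finally show ?case .
    qed
    ultimately show ?thesis by (auto simp: Linf_def)
  qed
  have lin: "AE x in \<mu>. T (\<lambda>g. a * f g + b * h g) x = a * T f x + b * T h x"
    if "f \<in> Linf m" "h \<in> Linf m" for a b f h
    using mean_value_cong[OF T[OF Linf_linear[OF that]] mean_value_linear[OF T[OF that(1)] T[OF that(2)]]]
    by simp
  have "linf_mean m \<mu> T"
    unfolding linf_mean_def
  proof (intro conjI ballI allI impI)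
    fix f assume f: "f \<in> Linf m"
    have "T f \<in> bounded_measurable \<mu>"
      using T[OF f] sets_\<mu> space_\<mu>
      by (simp add: mean_value_def bounded_measurable_def cong: measurable_cong_sets)
    then show "T f \<in> Linf \<mu>" using bounded_measurable_subset_Linf by blast
  next
    fix f h assume "f \<in> Linf m" "h \<in> Linf m" "AE g in m. f g = h g"
    then show "AE x in \<mu>. T f x = T h x" by (intro mean_value_cong[of f _ h] T)
  next
    fix f h assume "f \<in> Linf m" "h \<in> Linf m"
    from lin[OF this, of 1 1] show "AE x in \<mu>. T (\<lambda>g. f g + h g) x = T f x + T h x" by simp
  next
    fix f c assume "f \<in> Linf m"
    from lin[OF this this, of c 0] show "AE x in \<mu>. T (\<lambda>g. c * f g) x = c * T f x" by simp
  next
    fix f assume f: "f \<in> Linf m" and nn: "AE g in m. 0 \<le> f g"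
    have "mean_value (\<lambda>g. 0) (\<lambda>x. 0)"
      using mean_value_linear[OF mean_value_one mean_value_one, of 0 0] by simp
    from mean_value_mono[OF this T[OF f] nn] show "AE x in \<mu>. 0 \<le> T f x" .
  next
    show "AE x in \<mu>. T (\<lambda>_. 1) x = 1"
      by (rule mean_value_cong[OF T[OF const] mean_value_one]) simp
  qed
  moreover have "AE x in \<mu>. T (conv_arr G \<theta> f) x = conv_obj G \<theta> (T f) x"
    if \<theta>: "finite_ac_system G lam \<theta>" and f: "f \<in> Linf m" and c: "conv_arr G \<theta> f \<in> Linf m" for \<theta> f
  proof -
    have "mean_value (\<lambda>g. weight \<theta> (tgt G g) * conv_arr G \<theta> f g) (\<lambda>x. weight \<theta> x * T (conv_arr G \<theta> f) x)"
      by (intro mean_value_factor[OF T[OF c]] weight_bounded_measurable[OF \<theta>_system[OF \<theta>]]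
          less_imp_le[OF weight_pos(1)])
    moreover have "mean_value (\<lambda>g. weight \<theta> (tgt G g) * conv_arr G \<theta> f g)
        (\<lambda>x. weight \<theta> x * conv_obj G \<theta> (T f) x)"
      using f by (intro mean_value_convolution[OF T[OF f] _ \<theta>]) (simp add: Linf_def)
    ultimately have "AE x in \<mu>. weight \<theta> x * T (conv_arr G \<theta> f) x = weight \<theta> x * conv_obj G \<theta> (T f) x"
      by (rule mean_value_cong) simp
    then show ?thesis
    proof eventually_elim
      case (elim x)
      then show ?case using weight_pos(1)[of \<theta> x] by simp
    qed
  qed
  ultimately show ?thesis unfolding amenable_def by blast
qed

end

theorem theorem4p2:
  fixes G :: "('x, 'g) groupoid_data"
    and lam :: "'x \<Rightarrow> 'g measure"
    and \<mu> :: "'x measure"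
  assumes "measured_groupoid G lam \<mu>"
    and "\<exists>\<pi>. invariant_markov_on_measured G lam \<mu> \<pi> \<and> fiberwise_liouville lam \<mu> \<pi>"
  shows "amenable G lam \<mu>"
proof -
  obtain \<pi> where \<pi>: "invariant_markov_on_measured G lam \<mu> \<pi>" "fiberwise_liouville lam \<mu> \<pi>"
    using assms(2) by blast
  obtain U where "generalized_limit U"
    using generalized_limit_exists by blast
  then interpret liouville_groupoid G lam \<mu> \<pi> U
    using assms(1) \<pi> by unfold_locales
  show ?thesis by (rule amenable)
qed

end
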